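(* Let $\alpha>0$ and let $X=(X_t)_{t\in\mathbb{R}}$ be a real-valued two-sided Lévy process. The $\alpha$-Lipschitz minorant of (the sample path of) $X$ exists almost surely if and only if either - $\sigma=0$, $\Pi=0$ and $|d|=\alpha$ (equivalently, $X_t=\alpha t$ for all $t\in\mathbb{R}$ or $X_t=-\alpha t$ for all $t\in\mathbb{R}$), or - $\mathbb{E}[|X_1|]<\infty$ and $|\mathbb{E}[X_1]|<\alpha$.
   Context: A two-sided real-valued Lévy process $X=(X_t)_{t\in\mathbb{R}}$ has càdlàg paths, $X_0=0$, and for $s<t$ the increment $X_t-X_s$ is independent of $\{X_r:r\le s\}$ with the same distribution as $X_{t-s}$. For $t\ge0$, $\mathbb{E}[e^{i\theta X_t}]=e^{-t\Psi(\theta)}$ with $\Psi(\theta)=-ia\theta+\frac12\sigma^2\theta^2+\int_{\mathbb{R}}(1-e^{i\theta x}+i\theta x1_{\{|x|<1\}})\,\Pi(dx)$, where $a\in\mathbb{R}$, $\sigma\ge0$ and $\Pi$ (the Lévy measure) is a measure on $\mathbb{R}\setminus\{0\}$ with $\int(1\wedge x^2)\,\Pi(dx)<\infty$. When $\sigma=0$ and $\int(1\wedge|x|)\,\Pi(dx)<\infty$ (bounded variation paths), $\Psi(\theta)=-id\theta+\int_{\mathbb{R}}(1-e^{i\theta x})\,\Pi(dx)$ and $d$ is called the drift coefficient. A function $g:\mathbb{R}\to\mathbb{R}$ is $\alpha$-Lipschitz if $|g(s)-g(t)|\le\alpha|s-t|$ for all $s,t\in\mathbb{R}$. The $\alpha$-Lipschitz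 minorant of $f:\mathbb{R}\to\mathbb{R}$ is the greatest $\alpha$-Lipschitz function dominated by $f$; it exists if and only if at least one $\alpha$-Lipschitz function is dominated by $f$. *)

theory Defs
  imports "HOL-Probability.Probability"
begin

definition cadlag :: "(real \<Rightarrow> real) \<Rightarrow> bool" where
  "cadlag f \<longleftrightarrow> (\<forall>t. (f \<longlongrightarrow> f t) (at_right t) \<and> (\<exists>l. (f \<longlongrightarrow> l) (at_left t)))"

locale two_sided_levy_process = prob_space M
  for M :: "'w measure" and X :: "real \<Rightarrow> 'w \<Rightarrow> real" +
  assumes measurable_X: "\<And>t. X t \<in> borel_measurable M"
    and cadlag_paths: "\<And>\<omega>. \<omega> \<in> space M \<Longrightarrow> cadlag (\<lambda>t. X t \<omega>)"
    and X_zero: "\<And>\<omega>. \<omega> \<in> space M \<Longrightarrow> X 0 \<omega> = 0"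
    and indep_increment: "\<And>s t. s < t \<Longrightarrow>
      indep_set {(\<lambda>\<omega>. X t \<omega> - X s \<omega>) -` A \<inter> space M | A. A \<in> sets borel}
        (sigma_sets (space M) {X r -` A \<inter> space M | r A. r \<le> s \<and> A \<in> sets borel})"
    and stationary_increment: "\<And>s t. s < t \<Longrightarrow>
      distr M borel (\<lambda>\<omega>. X t \<omega> - X s \<omega>) = distr M borel (X (t - s))"

text \<open>A measure on \<open>\<real> - {0}\<close> is encoded as a Borel measure on \<open>\<real>\<close> without mass at \<open>0\<close>.\<close>

definition levy_measure :: "real measure \<Rightarrow> bool" where
  "levy_measure \<nu> \<longleftrightarrow> sets \<nu> = sets borel \<and> emeasure \<nu> {0} = 0 \<and>
     (\<integral>\<^sup>+x. ennreal (min 1 (x\<^sup>2)) \<partial>\<nu>) < \<infinity>"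

definition levy_exponent :: "real \<Rightarrow> real \<Rightarrow> real measure \<Rightarrow> real \<Rightarrow> complex" where
  "levy_exponent a \<sigma> \<nu> \<theta> =
     - \<i> * of_real (a * \<theta>) + of_real (\<sigma>\<^sup>2 * \<theta>\<^sup>2 / 2) +
     (CLINT x|\<nu>. 1 - iexp (\<theta> * x) + \<i> * of_real (\<theta> * x * indicator {x. \<bar>x\<bar> < 1} x))"

definition levy_triplet ::
  "'w measure \<Rightarrow> (real \<Rightarrow> 'w \<Rightarrow> real) \<Rightarrow> real \<Rightarrow> real \<Rightarrow> real measure \<Rightarrow> bool" where
  "levy_triplet M X a \<sigma> \<nu> \<longleftrightarrow> \<sigma> \<ge> 0 \<and> levy_measure \<nu> \<and>
     (\<forall>t\<ge>0. \<forall>\<theta>. char (distr M borel (X t)) \<theta> = exp (- of_real t * levy_exponent a \<sigma> \<nu> \<theta>))"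

text \<open>
  The drift coefficient exists only in the bounded variation case, hence a relation rather
  than a function; it determines \<open>d\<close> uniquely.
\<close>

definition has_drift_coefficient :: "real \<Rightarrow> real \<Rightarrow> real measure \<Rightarrow> real \<Rightarrow> bool" where
  "has_drift_coefficient a \<sigma> \<nu> d \<longleftrightarrow>
     \<sigma> = 0 \<and> (\<integral>\<^sup>+x. ennreal (min 1 \<bar>x\<bar>) \<partial>\<nu>) < \<infinity> \<and>
     (\<forall>\<theta>. levy_exponent a \<sigma> \<nu> \<theta> =
        - \<i> * of_real (d * \<theta>) + (CLINT x|\<nu>. 1 - iexp (\<theta> * x)))"

definition is_lipschitz_minorant :: "real \<Rightarrow> (real \<Rightarrow> real) \<Rightarrow> (real \<Rightarrow> real) \<Rightarrow> bool" where
  "is_lipschitz_minorant \<alpha> f m \<longleftrightarrow>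
     \<alpha>-lipschitz_on UNIV m \<and> (\<forall>t. m t \<le> f t) \<and>
     (\<forall>g. \<alpha>-lipschitz_on UNIV g \<and> (\<forall>t. g t \<le> f t) \<longrightarrow> (\<forall>t. g t \<le> m t))"

end

theory Submission
  imports Defs
begin

text \<open>
  A minorant exists iff \<open>X t + \<alpha> * \<bar>t\<bar>\<close> is bounded below. If the mean \<open>m\<close> of \<open>X 1\<close> satisfies
  \<open>\<bar>m\<bar> < \<alpha>\<close>, then the random walks \<open>X n + \<alpha> * n\<close> and \<open>X (- n) + \<alpha> * n\<close> have positive mean and are
  bounded below by Garsia's maximal ergodic argument. Ottaviani's inequality on dyadic grids
  carries the bound from the integers to all dyadic times, with a constant that does not depend on
  the mesh, and right-continuity carries it to all times.

  Conversely, \<open>X n\<close> and \<open>- X (- n)\<close> have the same law as random walks. Hence lower bounds on both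
  half-lines force the increments of one walk to grow at most linearly, which by Borel-Cantelli
  makes \<open>X 1\<close> integrable. A walk that is bounded below has nonnegative mean, and it vanishes if its
  mean is zero: its infimum \<open>I\<close> satisfies \<open>I \<le> Y + I'\<close> with \<open>I'\<close> a copy of \<open>I\<close> independent of the first
  step \<open>Y\<close>. So \<open>\<bar>m\<bar> \<le> \<alpha>\<close>, and \<open>\<bar>m\<bar> = \<alpha>\<close> forces \<open>X 1\<close> to be deterministic, in which case the
  characteristic exponent is purely imaginary.
\<close>

section \<open>Random walks with independent, identically distributed steps\<close>

text \<open>The least partial sum with at most \<open>n\<close> terms, the empty sum included.
  Peeling off the first term rather than the last matches the shift of the step sequence, on which
  the later arguments rest.\<close>

fun run_min :: "nat \<Rightarrow> (nat \<Rightarrow> real) \<Rightarrow> real" where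
  "run_min 0 y = 0"
| "run_min (Suc n) y = min 0 (y 0 + run_min n (\<lambda>i. y (Suc i)))"

lemma run_min_nonpos: "run_min n y \<le> 0"
  by (cases n) auto

lemma run_min_Suc_le: "run_min (Suc n) y \<le> run_min n y"
proof (induction n arbitrary: y)
  case (Suc n)
  have "min 0 (y 0 + run_min (Suc n) (\<lambda>i. y (Suc i))) \<le> min 0 (y 0 + run_min n (\<lambda>i. y (Suc i)))"
    using Suc[of "\<lambda>i. y (Suc i)"] by linarith
  then show ?case
    by (simp only: run_min.simps(2))
qed auto

lemma run_min_antimono: "m \<le> n \<Longrightarrow> run_min n y \<le> run_min m y"
  by (rule lift_Suc_antimono_le[of "\<lambda>n. run_min n y"]) (rule run_min_Suc_le)

lemma run_min_le_sum: "run_min n y \<le> (\<Sum>i<n. y i)"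
proof (induction n arbitrary: y)
  case (Suc n)
  have "run_min (Suc n) y \<le> y 0 + (\<Sum>i<n. y (Suc i))"
    using Suc[of "\<lambda>i. y (Suc i)"] by simp
  then show ?case
    by (simp only: sum.lessThan_Suc_shift)
qed auto

text \<open>The minimum is attained at one of the partial sums.\<close>

lemma run_min_ge_bound:
  assumes "\<And>n. (\<Sum>i<n. y i) \<ge> - C"
  shows "run_min n y \<ge> - C"
proof -
  have "\<exists>j. run_min n y = (\<Sum>i<j. y i)"
  proof (induction n arbitrary: y)
    case 0
    show ?case by (rule exI[of _ 0]) simp
  next
    case (Suc n)
    obtain j where "run_min n (\<lambda>i. y (Suc i)) = (\<Sum>i<j. y (Suc i))"
      using Suc[of "\<lambda>i. y (Suc i)"] by auto
    then have "run_min (Suc n) y = min (\<Sum>i<0. y i) (\<Sum>i<Suc j. y i)"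
      by (simp only: sum.lessThan_Suc_shift) simp
    moreover have "min (\<Sum>i<0. y i) (\<Sum>i<Suc j. y i) \<in> {\<Sum>i<0. y i, \<Sum>i<Suc j. y i}"
      by (simp only: min_def split: if_split) simp
    ultimately show ?case
      by (metis insertE singletonD)
  qed
  then obtain j where "run_min n y = (\<Sum>i<j. y i)" ..
  then show ?thesis
    using assms[of j] by simp
qed

text \<open>A natural number as bound keeps the quantifiers countable, so that the predicate is
  measurable.\<close>

definition sums_bdd_below :: "(nat \<Rightarrow> real) \<Rightarrow> bool" where
  "sums_bdd_below y \<longleftrightarrow> (\<exists>C::nat. \<forall>n. (\<Sum>i<n. y i) \<ge> - real C)"

lemma sums_bdd_belowI:
  assumes "\<And>n. (\<Sum>i<n. y i) \<ge> C"
  shows "sums_bdd_below y"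
proof -
  obtain k :: nat where "- C \<le> real k"
    using real_arch_simple by blast
  then show ?thesis
    unfolding sums_bdd_below_def using assms by (intro exI[of _ k] allI) (meson minus_le_iff order_trans)
qed

text \<open>Dropping the first term moves the remaining partial sums by the constant
  \<open>y 0\<close>. This makes boundedness from below a shift invariant event.\<close>

lemma sums_bdd_below_Suc: "sums_bdd_below (\<lambda>i. y (Suc i)) \<longleftrightarrow> sums_bdd_below y"
proof
  assume "sums_bdd_below (\<lambda>i. y (Suc i))"
  then obtain C :: nat where C: "\<And>n. (\<Sum>i<n. y (Suc i)) \<ge> - real C"
    unfolding sums_bdd_below_def by auto
  show "sums_bdd_below y"
  proof (rule sums_bdd_belowI[of "min 0 (y 0 - C)"])
    fix n show "min 0 (y 0 - C) \<le> sum y {..<n}"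
      using C[of "n - 1"] by (cases n) (auto simp: sum.lessThan_Suc_shift simp del: sum.lessThan_Suc)
  qed
next
  assume "sums_bdd_below y"
  then obtain C :: nat where C: "\<And>n. (\<Sum>i<n. y i) \<ge> - real C"
    unfolding sums_bdd_below_def by auto
  show "sums_bdd_below (\<lambda>i. y (Suc i))"
  proof (rule sums_bdd_belowI[of "- C - y 0"])
    fix n show "- C - y 0 \<le> (\<Sum>i<n. y (Suc i))"
      using C[of "Suc n"] by (auto simp: sum.lessThan_Suc_shift simp del: sum.lessThan_Suc)
  qed
qed

text \<open>A junk value unless the partial sums are bounded below.\<close>

definition inf_sums :: "(nat \<Rightarrow> real) \<Rightarrow> real" where
  "inf_sums y = lim (\<lambda>n. run_min n y)"

lemma run_min_tendsto_inf_sums: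
  assumes "sums_bdd_below y"
  shows "(\<lambda>n. run_min n y) \<longlonglongrightarrow> inf_sums y"
proof -
  obtain C :: nat where "\<And>n. (\<Sum>i<n. y i) \<ge> - real C"
    using assms unfolding sums_bdd_below_def by auto
  then have "\<And>n. - real C \<le> run_min n y"
    by (rule run_min_ge_bound)
  moreover have "decseq (\<lambda>n. run_min n y)"
    by (simp add: decseq_def run_min_antimono)
  ultimately obtain L where "(\<lambda>n. run_min n y) \<longlonglongrightarrow> L"
    using decseq_convergent by blast
  then show ?thesis
    unfolding inf_sums_def by (simp add: limI)
qed

text \<open>The recursion of \<open>run_min\<close> passes to the limit.\<close>

lemma inf_sums_Suc:
  assumes "sums_bdd_below y"
  shows "inf_sums y = min 0 (y 0 + inf_sums (\<lambda>i. y (Suc i)))"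
proof (rule LIMSEQ_unique)
  show "(\<lambda>n. run_min (Suc n) y) \<longlonglongrightarrow> inf_sums y"
    using run_min_tendsto_inf_sums[OF assms] by (rule LIMSEQ_Suc)
  show "(\<lambda>n. run_min (Suc n) y) \<longlonglongrightarrow> min 0 (y 0 + inf_sums (\<lambda>i. y (Suc i)))"
    unfolding run_min.simps(2) using assms
    by (intro tendsto_intros run_min_tendsto_inf_sums) (simp add: sums_bdd_below_Suc)
qed

section \<open>Measurability on the space of step sequences\<close>

abbreviation seq_borel :: "(nat \<Rightarrow> real) measure" where
  "seq_borel \<equiv> PiM UNIV (\<lambda>_. borel)"

lemma measurable_shift: "(\<lambda>y i. y (Suc i)) \<in> seq_borel \<rightarrow>\<^sub>M seq_borel"
  by (rule measurable_PiM_single') auto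

lemma measurable_run_min [measurable]: "run_min n \<in> borel_measurable seq_borel"
proof (induction n)
  case 0
  have "run_min 0 = (\<lambda>_. 0)" by (rule ext) (rule run_min.simps(1))
  then show ?case by simp
next
  case (Suc n)
  have "run_min (Suc n) = (\<lambda>y. min 0 (y 0 + run_min n (\<lambda>i. y (Suc i))))"
    by (rule ext) (rule run_min.simps(2))
  moreover have "\<dots> \<in> borel_measurable seq_borel"
    by (intro borel_measurable_min borel_measurable_add borel_measurable_const
        measurable_compose[OF measurable_shift Suc]) measurable
  ultimately show ?case by metis
qed

text \<open>Supplies the majorant that makes the running minimum of integrable steps
  integrable.\<close>

lemma run_min_ge_sum_abs: "- (\<Sum>i<n. \<bar>y i\<bar>) \<le> run_min n y"
proof (induction n arbitrary: y)
  case (Suc n)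
  have "- (\<bar>y 0\<bar> + (\<Sum>i<n. \<bar>y (Suc i)\<bar>)) \<le> min 0 (y 0 + run_min n (\<lambda>i. y (Suc i)))"
    using Suc[of "\<lambda>i. y (Suc i)"] sum_nonneg[of "{..<n}" "\<lambda>i. \<bar>y (Suc i)\<bar>"] by (smt (verit) abs_ge_zero)
  then show ?case
    by (simp only: run_min.simps(2) sum.lessThan_Suc_shift)
qed auto

lemma measurable_inf_sums [measurable]: "inf_sums \<in> borel_measurable seq_borel"
  unfolding inf_sums_def[abs_def] by (rule borel_measurable_lim_metric) (rule measurable_run_min)

lemma pred_sums_bdd_below [measurable]: "Measurable.pred seq_borel sums_bdd_below"
  unfolding sums_bdd_below_def[abs_def] by measurable

text \<open>Used with \<open>Suc\<close> to discard the first step and with injections of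
  \<open>nat\<close> into \<open>int\<close> to enumerate the increments along a half-line.\<close>

lemma (in prob_space) indep_vars_reindex:
  assumes indep: "indep_vars M' X I" and f: "inj_on f J" "f ` J \<subseteq> I"
  shows "indep_vars (\<lambda>j. M' (f j)) (\<lambda>j. X (f j)) J"
  unfolding indep_vars_def2
proof (intro conjI ballI indep_setsI)
  fix j assume "j \<in> J"
  then show rv: "random_variable (M' (f j)) (X (f j))"
    using indep f unfolding indep_vars_def2 by auto
  then show "{X (f j) -` A \<inter> space M |A. A \<in> sets (M' (f j))} \<subseteq> events"
    by auto
next
  fix A K assume K: "K \<noteq> {}" "K \<subseteq> J" "finite K"
    and A: "\<forall>j\<in>K. A j \<in> {X (f j) -` A \<inter> space M |A. A \<in> sets (M' (f j))}"
  define B where "B i = A (the_inv_into K f i)" for i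
  have inj: "inj_on f K"
    using f K inj_on_subset by blast
  have B: "B (f j) = A j" if "j \<in> K" for j
    using inj that by (simp add: B_def the_inv_into_f_f)
  have "prob (\<Inter>i\<in>f ` K. B i) = (\<Prod>i\<in>f ` K. prob (B i))"
    using indep K f A B unfolding indep_vars_def2
    by (intro indep_setsD[of _ I]) auto
  then show "prob (\<Inter>j\<in>K. A j) = (\<Prod>j\<in>K. prob (A j))"
    using inj by (simp add: prod.reindex B)
qed

section \<open>Joint law of the steps and its invariance under the shift\<close>

locale iid_walk = prob_space M for M :: "'w measure" +
  fixes Y :: "nat \<Rightarrow> 'w \<Rightarrow> real"
  assumes indep: "indep_vars (\<lambda>_. borel) Y UNIV"
    and ident: "\<And>n. distr M borel (Y n) = distr M borel (Y 0)"
begin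

lemma measurable_step [measurable]: "Y n \<in> borel_measurable M"
  using indep unfolding indep_vars_def by auto

lemma measurable_steps: "(\<lambda>\<omega> n. Y n \<omega>) \<in> M \<rightarrow>\<^sub>M seq_borel"
  by (rule measurable_PiM_single') auto

text \<open>Independence makes the joint law a product and identical distribution makes the factors
  equal, so the law of one step determines the law of the whole walk.\<close>

lemma distr_steps: "distr M seq_borel (\<lambda>\<omega> n. Y n \<omega>) = PiM UNIV (\<lambda>_. distr M borel (Y 0))"
proof -
  have "distr M seq_borel (\<lambda>\<omega> n. Y n \<omega>) = PiM UNIV (\<lambda>n. distr M borel (Y n))"
    using indep_vars_iff_distr_eq_PiM[where I = UNIV and M' = "\<lambda>_. borel" and X = Y] indep
    by (simp add: restrict_UNIV)
  also have "(\<lambda>n. distr M borel (Y n)) = (\<lambda>_. distr M borel (Y 0))"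
    using ident by blast
  finally show ?thesis .
qed

lemma iid_walk_Suc: "iid_walk M (\<lambda>n. Y (Suc n))"
proof
  show "indep_vars (\<lambda>_. borel) (\<lambda>n. Y (Suc n)) UNIV"
    using indep_vars_reindex[OF indep, of Suc UNIV] by simp
  show "\<And>n. distr M borel (Y (Suc n)) = distr M borel (Y (Suc 0))"
    using ident by metis
qed

lemma iid_walk_compose:
  assumes [measurable]: "g \<in> borel_measurable borel"
  shows "iid_walk M (\<lambda>n \<omega>. g (Y n \<omega>))"
proof
  show "indep_vars (\<lambda>_. borel) (\<lambda>n \<omega>. g (Y n \<omega>)) UNIV"
    using indep by (rule indep_vars_compose2[where Y = "\<lambda>_. g"]) simp
  have "distr M borel (\<lambda>\<omega>. g (Y n \<omega>)) = distr (distr M borel (Y n)) borel g" for n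
    by (subst distr_distr) (auto simp: comp_def)
  then show "distr M borel (\<lambda>\<omega>. g (Y n \<omega>)) = distr M borel (\<lambda>\<omega>. g (Y 0 \<omega>))" for n
    using ident by metis
qed

text \<open>Both step sequences have the same product law. This transfers almost sure properties
  between walks that agree only in distribution.\<close>

lemma AE_steps_iff:
  assumes Z: "iid_walk M Z" and law: "distr M borel (Y 0) = distr M borel (Z 0)"
    and [measurable]: "Measurable.pred seq_borel P"
  shows "(AE \<omega> in M. P (\<lambda>n. Y n \<omega>)) \<longleftrightarrow> (AE \<omega> in M. P (\<lambda>n. Z n \<omega>))"
proof -
  have "(AE y in distr M seq_borel (\<lambda>\<omega> n. Y n \<omega>). P y) \<longleftrightarrow> (AE y in distr M seq_borel (\<lambda>\<omega> n. Z n \<omega>). P y)"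
    by (simp only: distr_steps iid_walk.distr_steps[OF Z] law)
  then show ?thesis
    using measurable_steps iid_walk.measurable_steps[OF Z] by (simp add: AE_distr_iff)
qed

lemma distr_shift: "distr M seq_borel (\<lambda>\<omega> n. Y (Suc n) \<omega>) = distr M seq_borel (\<lambda>\<omega> n. Y n \<omega>)"
  using iid_walk.distr_steps[OF iid_walk_Suc] distr_steps ident by metis

text \<open>The shifted sequence involves only the coordinates from 1 on, and disjoint blocks of
  coordinates are independent.\<close>

lemma indep_first_rest:
  assumes [measurable]: "F \<in> borel_measurable seq_borel"
  shows "indep_var borel (Y 0) borel (\<lambda>\<omega>. F (\<lambda>n. Y (Suc n) \<omega>))"
proof -
  have *: "(\<lambda>y i. y (Suc i)) \<in> PiM {1..} (\<lambda>_. borel :: real measure) \<rightarrow>\<^sub>M seq_borel"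
    by (rule measurable_PiM_single') auto
  have "indep_var borel ((\<lambda>y. y (0::nat)) \<circ> (\<lambda>\<omega>. restrict (\<lambda>i. Y i \<omega>) {0}))
      borel ((\<lambda>y. F (\<lambda>i. y (Suc i))) \<circ> (\<lambda>\<omega>. restrict (\<lambda>i. Y i \<omega>) {1..}))"
    by (rule indep_var_compose[OF indep_var_restrict[OF indep]])
      (use * in \<open>auto intro: measurable_compose[OF _ assms]\<close>)
  then show ?thesis
    by (simp add: comp_def)
qed

lemma integral_shift:
  fixes F :: "(nat \<Rightarrow> real) \<Rightarrow> real"
  assumes [measurable]: "F \<in> borel_measurable seq_borel"
  shows "expectation (\<lambda>\<omega>. F (\<lambda>n. Y (Suc n) \<omega>)) = expectation (\<lambda>\<omega>. F (\<lambda>n. Y n \<omega>))"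
proof -
  have "(\<integral>y. F y \<partial>distr M seq_borel (\<lambda>\<omega> n. Y (Suc n) \<omega>)) = (\<integral>y. F y \<partial>distr M seq_borel (\<lambda>\<omega> n. Y n \<omega>))"
    by (simp only: distr_shift)
  then show ?thesis
    using measurable_steps iid_walk.measurable_steps[OF iid_walk_Suc] by (simp add: integral_distr)
qed

lemma integrable_shift:
  fixes F :: "(nat \<Rightarrow> real) \<Rightarrow> real"
  assumes [measurable]: "F \<in> borel_measurable seq_borel"
  shows "integrable M (\<lambda>\<omega>. F (\<lambda>n. Y (Suc n) \<omega>)) \<longleftrightarrow> integrable M (\<lambda>\<omega>. F (\<lambda>n. Y n \<omega>))"
proof -
  have "integrable (distr M seq_borel (\<lambda>\<omega> n. Y (Suc n) \<omega>)) F \<longleftrightarrow> integrable (distr M seq_borel (\<lambda>\<omega> n. Y n \<omega>)) F"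
    by (simp only: distr_shift)
  then show ?thesis
    using measurable_steps iid_walk.measurable_steps[OF iid_walk_Suc] by (simp add: integrable_distr_eq)
qed

lemma integrable_step:
  assumes "integrable M (Y 0)"
  shows "integrable M (Y n)"
proof -
  have "integrable (distr M borel (Y n)) (\<lambda>x. x)"
    using assms by (subst ident) (simp add: integrable_distr_eq)
  then show ?thesis
    by (simp add: integrable_distr_eq)
qed

lemma integrable_run_min:
  assumes "integrable M (Y 0)"
  shows "integrable M (\<lambda>\<omega>. run_min n (\<lambda>i. Y i \<omega>))"
proof (rule Bochner_Integration.integrable_bound)
  show "integrable M (\<lambda>\<omega>. \<Sum>i<n. \<bar>Y i \<omega>\<bar>)"
    using integrable_step[OF assms] by auto
  show "(\<lambda>\<omega>. run_min n (\<lambda>i. Y i \<omega>)) \<in> borel_measurable M"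
    by (rule measurable_compose[OF measurable_steps measurable_run_min])
  show "AE \<omega> in M. norm (run_min n (\<lambda>i. Y i \<omega>)) \<le> norm (\<Sum>i<n. \<bar>Y i \<omega>\<bar>)"
  proof (rule AE_I2)
    fix \<omega>
    show "norm (run_min n (\<lambda>i. Y i \<omega>)) \<le> norm (\<Sum>i<n. \<bar>Y i \<omega>\<bar>)"
      using run_min_ge_sum_abs[of "\<lambda>i. Y i \<omega>" n] run_min_nonpos[of n "\<lambda>i. Y i \<omega>"] by simp
  qed
qed

text \<open>
  Garsia's proof of the maximal ergodic lemma, carried out on the shift invariant event that the
  partial sums are unbounded below; this event is independent of the first step.
\<close>

lemma sums_bdd_below_AE:
  assumes int: "integrable M (Y 0)" and pos: "expectation (Y 0) > 0"
  shows "AE \<omega> in M. sums_bdd_below (\<lambda>n. Y n \<omega>)"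
proof -
  \<comment> \<open>\<open>b\<close> is the indicator of the bad event that the partial sums are
    unbounded below; the aim is that \<open>B\<close> vanishes almost surely.\<close>
  define b :: "(nat \<Rightarrow> real) \<Rightarrow> real" where "b y = (if sums_bdd_below y then 0 else 1)" for y
  have b_meas [measurable]: "b \<in> borel_measurable seq_borel"
    unfolding b_def[abs_def] by measurable
  have b_shift: "b (\<lambda>n. y (Suc n)) = b y" for y
    by (simp add: b_def sums_bdd_below_Suc)
  have b01: "0 \<le> b y" "b y \<le> 1" for y
    by (auto simp: b_def)
  define B where "B \<omega> = b (\<lambda>n. Y n \<omega>)" for \<omega>
  have B_meas [measurable]: "B \<in> borel_measurable M"
    unfolding B_def[abs_def] by (rule measurable_compose[OF measurable_steps b_meas])
  have B01: "0 \<le> B \<omega>" "B \<omega> \<le> 1" for \<omega>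
    by (auto simp: B_def b01)
  have bY_shift: "b (\<lambda>n. Y (Suc n) \<omega>) = b (\<lambda>n. Y n \<omega>)" for \<omega>
    by (rule b_shift)
  then have B_shift: "B \<omega> = b (\<lambda>n. Y (Suc n) \<omega>)" for \<omega>
    by (simp add: B_def)
  have int_B: "integrable M B"
    by (rule integrable_const_bound[of _ 1]) (auto simp: B_def b_def)
  define R where "R n \<omega> = run_min n (\<lambda>i. Y i \<omega>)" for n \<omega>
  define R' where "R' n \<omega> = run_min n (\<lambda>i. Y (Suc i) \<omega>)" for n \<omega>
  have R_meas [measurable]: "R n \<in> borel_measurable M" for n
    unfolding R_def[abs_def] by (rule measurable_compose[OF measurable_steps measurable_run_min])
  have Rb_meas: "(\<lambda>y. run_min n y * b y) \<in> borel_measurable seq_borel" for n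
    by measurable
  have int_RB: "integrable M (\<lambda>\<omega>. R n \<omega> * B \<omega>)" for n
    using integrable_run_min[OF int, of n]
    by (rule Bochner_Integration.integrable_bound) (use B01 in \<open>auto simp: R_def[symmetric] abs_mult mult_left_le\<close>)
  then have int_R'B: "integrable M (\<lambda>\<omega>. R' n \<omega> * B \<omega>)" for n
    using integrable_shift[OF Rb_meas[of n]] unfolding R_def B_def R'_def by (simp add: bY_shift)
  have R'B: "expectation (\<lambda>\<omega>. R' n \<omega> * B \<omega>) = expectation (\<lambda>\<omega>. R n \<omega> * B \<omega>)" for n
    using integral_shift[OF Rb_meas[of n]] unfolding R_def B_def R'_def by (simp add: bY_shift)
  \<comment> \<open>The first step, restricted to the bad event and to walks that become negative
    within \<open>Suc n\<close> steps.\<close>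
  define H where "H n \<omega> = (if R (Suc n) \<omega> < 0 then Y 0 \<omega> * B \<omega> else 0)" for n \<omega>
  have H_meas [measurable]: "H n \<in> borel_measurable M" for n
    unfolding H_def[abs_def] by measurable
  have H_bound: "\<bar>H n \<omega>\<bar> \<le> \<bar>Y 0 \<omega>\<bar>" for n \<omega>
    by (auto simp: H_def B_def b_def)
  have int_H: "integrable M (H n)" for n
    using int by (rule Bochner_Integration.integrable_bound) (auto simp: H_bound)
  \<comment> \<open>If \<open>R (Suc n)\<close> is negative, it equals \<open>Y 0\<close> plus
    \<open>R' n\<close> and equality holds; otherwise it is 0 and only \<open>R' n\<close> being
    nonpositive matters.\<close>
  have H_le: "H n \<omega> \<le> R (Suc n) \<omega> * B \<omega> - R' n \<omega> * B \<omega>" for n \<omega>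
  proof -
    have "R (Suc n) \<omega> = min 0 (Y 0 \<omega> + R' n \<omega>)" "R' n \<omega> \<le> 0"
      by (auto simp: R_def R'_def run_min_nonpos)
    then show ?thesis
      by (auto simp: H_def B_def b_def)
  qed
  \<comment> \<open>Shift invariance replaces \<open>R' n\<close> by \<open>R n\<close> under the
    expectation, and the running minimum decreases in \<open>n\<close>.\<close>
  have "expectation (H n) \<le> 0" for n
  proof -
    have "expectation (H n) \<le> expectation (\<lambda>\<omega>. R (Suc n) \<omega> * B \<omega> - R' n \<omega> * B \<omega>)"
      using int_H int_RB int_R'B H_le by (intro integral_mono) auto
    also have "\<dots> = expectation (\<lambda>\<omega>. R (Suc n) \<omega> * B \<omega>) - expectation (\<lambda>\<omega>. R n \<omega> * B \<omega>)"
      using int_RB int_R'B R'B by simp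
    also have "\<dots> \<le> 0"
    proof -
      have "expectation (\<lambda>\<omega>. R (Suc n) \<omega> * B \<omega>) \<le> expectation (\<lambda>\<omega>. R n \<omega> * B \<omega>)"
        using int_RB run_min_Suc_le b01
        by (intro integral_mono) (auto simp: R_def B_def simp del: run_min.simps intro!: mult_right_mono)
      then show ?thesis by simp
    qed
    finally show ?thesis .
  qed
  \<comment> \<open>On the bad event every walk eventually becomes negative, so the restriction on
    the walk disappears in the limit.\<close>
  moreover have "(\<lambda>n. expectation (H n)) \<longlonglongrightarrow> expectation (\<lambda>\<omega>. Y 0 \<omega> * B \<omega>)"
  proof (rule integral_dominated_convergence[where w = "\<lambda>\<omega>. \<bar>Y 0 \<omega>\<bar>"])
    show "AE \<omega> in M. (\<lambda>n. H n \<omega>) \<longlonglongrightarrow> Y 0 \<omega> * B \<omega>"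
    proof (rule AE_I2)
      fix \<omega>
      show "(\<lambda>n. H n \<omega>) \<longlonglongrightarrow> Y 0 \<omega> * B \<omega>"
      proof (cases "B \<omega> = 0")
        case True
        then have "H n \<omega> = 0" for n by (simp add: H_def)
        with True show ?thesis by simp
      next
        case False
        then have "\<not> sums_bdd_below (\<lambda>n. Y n \<omega>)"
          by (auto simp: B_def b_def)
        then obtain j where j: "(\<Sum>i<j. Y i \<omega>) < 0"
          using sums_bdd_belowI[of 0] by (meson not_le)
        have "R (Suc n) \<omega> < 0" if "n \<ge> j" for n
          using j that run_min_le_sum[of j "\<lambda>i. Y i \<omega>"] run_min_antimono[of j "Suc n" "\<lambda>i. Y i \<omega>"]
          unfolding R_def by linarith
        then have "eventually (\<lambda>n. H n \<omega> = Y 0 \<omega> * B \<omega>) sequentially"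
          by (auto simp: H_def eventually_sequentially)
        then show ?thesis
          by (rule tendsto_eventually)
      qed
    qed
  qed (use int H_bound in auto)
  ultimately have "expectation (\<lambda>\<omega>. Y 0 \<omega> * B \<omega>) \<le> 0"
    by (meson LIMSEQ_le_const2)
  \<comment> \<open>By invariance \<open>B\<close> is a function of the later steps alone, hence
    independent of \<open>Y 0\<close>. A positive mean then leaves no room for a positive
    expectation of \<open>B\<close>.\<close>
  moreover have "expectation (\<lambda>\<omega>. Y 0 \<omega> * B \<omega>) = expectation (Y 0) * expectation B"
    using indep_first_rest[OF b_meas] int int_B
    by (intro indep_var_lebesgue_integral) (simp_all add: B_shift[symmetric, abs_def])
  ultimately have "expectation B \<le> 0"
    using pos by (simp add: mult_le_0_iff)
  moreover have "expectation B \<ge> 0"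
    using b01 by (intro integral_nonneg_AE) (auto simp: B_def)
  ultimately have "AE \<omega> in M. B \<omega> = 0"
    using int_B b01 by (subst integral_nonneg_eq_0_iff_AE[symmetric]) (auto simp: B_def)
  then show ?thesis
    by eventually_elim (auto simp: B_def b_def split: if_splits)
qed

text \<open>The infimum \<open>I\<close> and its shifted copy \<open>I'\<close> have the same law,
  so formally \<open>D = Y 0 + I' - I \<ge> 0\<close> has the mean of \<open>Y 0\<close>. Since
  \<open>I\<close> need not be integrable, truncation and Fatou's lemma are used instead, and they
  give \<open>expectation D \<le> expectation (Y 0)\<close>.\<close>

lemma
  assumes int: "integrable M (Y 0)" and bdd: "AE \<omega> in M. sums_bdd_below (\<lambda>n. Y n \<omega>)"
  shows expectation_nonneg_of_bdd_below: "expectation (Y 0) \<ge> 0"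
    and AE_eq_0_of_bdd_below: "expectation (Y 0) = 0 \<Longrightarrow> AE \<omega> in M. Y 0 \<omega> = 0"
proof -
  define I where "I \<omega> = inf_sums (\<lambda>n. Y n \<omega>)" for \<omega>
  define I' where "I' \<omega> = inf_sums (\<lambda>n. Y (Suc n) \<omega>)" for \<omega>
  have I_meas [measurable]: "I \<in> borel_measurable M"
    unfolding I_def[abs_def] by (rule measurable_compose[OF measurable_steps measurable_inf_sums])
  have I'_meas [measurable]: "I' \<in> borel_measurable M"
    unfolding I'_def[abs_def]
    by (rule measurable_compose[OF iid_walk.measurable_steps[OF iid_walk_Suc] measurable_inf_sums])
  have I_eq: "AE \<omega> in M. I \<omega> = min 0 (Y 0 \<omega> + I' \<omega>)"
    using bdd by eventually_elim (auto simp: I_def I'_def inf_sums_Suc)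
  have I'_le: "AE \<omega> in M. I' \<omega> \<le> 0"
  proof -
    have "AE \<omega> in M. inf_sums (\<lambda>n. Y n \<omega>) \<le> 0"
      using bdd by eventually_elim (auto simp: inf_sums_Suc)
    then show ?thesis
      unfolding I'_def by (subst iid_walk.AE_steps_iff[OF iid_walk_Suc iid_walk_axioms ident, of "\<lambda>y. inf_sums y \<le> 0"]) measurable
  qed
  \<comment> \<open>Truncation to the interval from \<open>- k\<close> to 0 makes the two infima
    integrable, so that their equal laws cancel in the expectation.\<close>
  define T where "T k x = max (- real k) (min 0 x)" for k :: nat and x :: real
  have T_meas [measurable]: "T k \<in> borel_measurable borel" for k
    unfolding T_def[abs_def] by measurable
  have T_bound: "\<bar>T k x\<bar> \<le> real k" for k x
    by (auto simp: T_def)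
  have TI_meas: "(\<lambda>y. T k (inf_sums y)) \<in> borel_measurable seq_borel" for k
    by measurable
  have int_T: "integrable M (\<lambda>\<omega>. T k (I \<omega>))" "integrable M (\<lambda>\<omega>. T k (I' \<omega>))" for k
    using T_bound by (intro integrable_const_bound[of _ "real k"]; simp)+
  have E_T: "expectation (\<lambda>\<omega>. T k (I' \<omega>)) = expectation (\<lambda>\<omega>. T k (I \<omega>))" for k
    using integral_shift[OF TI_meas[of k]] by (simp add: I_def I'_def)
  \<comment> \<open>The negative part of the first step is added to make \<open>W k\<close>
    nonnegative, as Fatou's lemma requires; \<open>T k\<close> is monotone and does not increase
    distances.\<close>
  define N where "N \<omega> = max 0 (- Y 0 \<omega>)" for \<omega>
  have N_meas [measurable]: "N \<in> borel_measurable M"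
    unfolding N_def[abs_def] by measurable
  have int_N: "integrable M N"
    unfolding N_def[abs_def] using int by auto
  define W where "W k \<omega> = Y 0 \<omega> + T k (I' \<omega>) - T k (I \<omega>) + N \<omega>" for k \<omega>
  have W_meas [measurable]: "W k \<in> borel_measurable M" for k
    unfolding W_def[abs_def] by measurable
  have int_W: "integrable M (W k)" for k
    unfolding W_def[abs_def] using int int_T int_N by auto
  have E_W: "expectation (W k) = expectation (Y 0) + expectation N" for k
    unfolding W_def[abs_def] using int int_T int_N E_T by simp
  have W_nonneg: "AE \<omega> in M. 0 \<le> W k \<omega>" for k
    using I_eq I'_le by eventually_elim (auto simp: W_def T_def N_def)
  define D where "D \<omega> = Y 0 \<omega> + I' \<omega> - I \<omega>" for \<omega>
  have D_meas [measurable]: "D \<in> borel_measurable M"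
    unfolding D_def[abs_def] by measurable
  have D_nonneg: "AE \<omega> in M. 0 \<le> D \<omega>"
    using I_eq by eventually_elim (auto simp: D_def)
  have N_nonneg: "0 \<le> N \<omega>" for \<omega>
    by (simp add: N_def)
  have lim: "AE \<omega> in M. (\<lambda>k. ennreal (W k \<omega>)) \<longlonglongrightarrow> ennreal (D \<omega> + N \<omega>)"
    using I_eq I'_le
  proof eventually_elim
    fix \<omega> assume I: "I \<omega> = min 0 (Y 0 \<omega> + I' \<omega>)" and I': "I' \<omega> \<le> 0"
    obtain K :: nat where K: "max (- I \<omega>) (- I' \<omega>) \<le> real K"
      using real_arch_simple by blast
    have "W k \<omega> = D \<omega> + N \<omega>" if "k \<ge> K" for k
    proof -
      have "real K \<le> real k" using that by simp
      then show ?thesis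
        using K I I' by (auto simp: W_def D_def T_def)
    qed
    then have "eventually (\<lambda>k. ennreal (W k \<omega>) = ennreal (D \<omega> + N \<omega>)) sequentially"
      unfolding eventually_sequentially by (intro exI[of _ K]) simp
    then show "(\<lambda>k. ennreal (W k \<omega>)) \<longlonglongrightarrow> ennreal (D \<omega> + N \<omega>)"
      by (rule tendsto_eventually)
  qed
  have EN: "0 \<le> expectation (Y 0) + expectation N"
    using integral_nonneg_AE[OF W_nonneg[of 0]] E_W[of 0] by simp
  \<comment> \<open>Fatou's lemma: almost surely \<open>W k\<close> eventually equals
    \<open>D + N\<close>, and its expectation does not depend on \<open>k\<close>.\<close>
  have "(\<integral>\<^sup>+\<omega>. ennreal (D \<omega> + N \<omega>) \<partial>M) = (\<integral>\<^sup>+\<omega>. liminf (\<lambda>k. ennreal (W k \<omega>)) \<partial>M)"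
    using lim by (intro nn_integral_cong_AE, eventually_elim) (simp add: lim_imp_Liminf)
  also have "\<dots> \<le> liminf (\<lambda>k. \<integral>\<^sup>+\<omega>. ennreal (W k \<omega>) \<partial>M)"
    by (rule nn_integral_liminf) simp
  also have "(\<lambda>k. \<integral>\<^sup>+\<omega>. ennreal (W k \<omega>) \<partial>M) = (\<lambda>_. ennreal (expectation (Y 0) + expectation N))"
    using int_W W_nonneg E_W by (simp add: nn_integral_eq_integral)
  finally have nn_le: "(\<integral>\<^sup>+\<omega>. ennreal (D \<omega> + N \<omega>) \<partial>M) \<le> ennreal (expectation (Y 0) + expectation N)"
    by (simp add: Liminf_const)
  have DN_nonneg: "AE \<omega> in M. 0 \<le> D \<omega> + N \<omega>"
    using D_nonneg by eventually_elim (simp add: N_def)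
  have int_DN: "integrable M (\<lambda>\<omega>. D \<omega> + N \<omega>)"
    using nn_le DN_nonneg by (intro integrableI_nonneg) (auto intro: le_less_trans)
  then have "ennreal (expectation (\<lambda>\<omega>. D \<omega> + N \<omega>)) \<le> ennreal (expectation (Y 0) + expectation N)"
    using nn_le DN_nonneg by (simp add: nn_integral_eq_integral)
  then have "expectation (\<lambda>\<omega>. D \<omega> + N \<omega>) \<le> expectation (Y 0) + expectation N"
    using EN by simp
  moreover have int_D: "integrable M D"
    using Bochner_Integration.integrable_diff[OF int_DN int_N] by simp
  ultimately have E_D: "expectation D \<le> expectation (Y 0)"
    using int_N by simp
  moreover have "0 \<le> expectation D"
    using D_nonneg by (rule integral_nonneg_AE)
  ultimately show "0 \<le> expectation (Y 0)"
    by simp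
  assume mean: "expectation (Y 0) = 0"
  then have "expectation D = 0"
    using E_D \<open>0 \<le> expectation D\<close> by simp
  then have "AE \<omega> in M. D \<omega> = 0"
    using int_D D_nonneg by (simp add: integral_nonneg_eq_0_iff_AE)
  then have I_step: "AE \<omega> in M. I \<omega> = Y 0 \<omega> + I' \<omega>"
    by eventually_elim (simp add: D_def)
  text \<open>
    \<open>I\<close> and \<open>I'\<close> have the same law and \<open>I'\<close> is independent of the first step, so a step that is
    positive with positive probability would raise the essential supremum of \<open>I\<close>.
  \<close>
  have small: "prob {\<omega>\<in>space M. \<epsilon> < Y 0 \<omega>} = 0" if "\<epsilon> > 0" for \<epsilon>
  proof -
    define J where "J k = {\<omega>\<in>space M. - (real k * \<epsilon>) < I \<omega>}" for k
    have "\<exists>k. prob (J k) \<noteq> 0"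
    proof (rule ccontr)
      assume "\<nexists>k. prob (J k) \<noteq> 0"
      then have "AE \<omega> in M. \<omega> \<notin> J k" for k
        by (subst prob_eq_0[symmetric]) (auto simp: J_def)
      then have "AE \<omega> in M. \<forall>k. \<omega> \<notin> J k"
        by (simp add: AE_all_countable)
      with AE_space have "AE \<omega> in M. False"
      proof eventually_elim
        case (elim \<omega>)
        obtain k :: nat where "- I \<omega> / \<epsilon> < real k"
          using reals_Archimedean2 by blast
        then show False
          using elim(1) elim(2)[rule_format, of k] \<open>\<epsilon> > 0\<close> by (simp add: J_def field_simps)
      qed
      then show False by simp
    qed
    \<comment> \<open>The first level below 0, in multiples of \<open>\<epsilon>\<close>, that
      \<open>I\<close> exceeds with positive probability. It is not level 0 because \<open>I\<close>
      is almost surely nonpositive, so it has a predecessor \<open>j\<close>, and \<open>J j\<close>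
      is null.\<close>
    define k where "k = (LEAST k. prob (J k) \<noteq> 0)"
    have k: "prob (J k) \<noteq> 0"
      unfolding k_def using \<open>\<exists>k. prob (J k) \<noteq> 0\<close> by (rule LeastI_ex)
    have "prob (J 0) = 0"
    proof (subst prob_eq_0)
      show "AE \<omega> in M. \<omega> \<notin> J 0"
        using I_eq by eventually_elim (auto simp: J_def)
    qed (auto simp: J_def)
    then obtain j where j: "k = Suc j"
      using k by (cases k) auto
    then have "prob (J j) = 0"
      using not_less_Least[of j "\<lambda>k. prob (J k) \<noteq> 0"] by (auto simp: k_def)
    then have J_j: "AE \<omega> in M. \<omega> \<notin> J j"
      by (subst prob_eq_0[symmetric]) (auto simp: J_def)
    have "prob {\<omega>\<in>space M. \<epsilon> < Y 0 \<omega>} * prob {\<omega>\<in>space M. - (real k * \<epsilon>) < I' \<omega>}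
        = prob ((\<lambda>\<omega>. (Y 0 \<omega>, I' \<omega>)) -` ({\<epsilon><..} \<times> {- (real k * \<epsilon>)<..}) \<inter> space M)"
      using indep_varD[OF indep_first_rest[OF measurable_inf_sums], of "{\<epsilon><..}" "{- (real k * \<epsilon>)<..}"]
      by (simp add: I'_def[abs_def] vimage_def Int_def conj_commute)
    \<comment> \<open>A first step above \<open>\<epsilon>\<close> together with \<open>I'\<close>
      above level \<open>k\<close> would put \<open>I\<close> above level \<open>j\<close>.\<close>
    also have "\<dots> = 0"
    proof (subst prob_eq_0)
      show "AE \<omega> in M. \<omega> \<notin> (\<lambda>\<omega>. (Y 0 \<omega>, I' \<omega>)) -` ({\<epsilon><..} \<times> {- (real k * \<epsilon>)<..}) \<inter> space M"
        using I_step J_j by eventually_elim (auto simp: J_def j algebra_simps)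
    qed measurable
    finally have "prob {\<omega>\<in>space M. \<epsilon> < Y 0 \<omega>} * prob {\<omega>\<in>space M. - (real k * \<epsilon>) < I' \<omega>} = 0" .
    moreover have "prob {\<omega>\<in>space M. - (real k * \<epsilon>) < I' \<omega>} = prob (J k)"
    proof -
      have [measurable]: "{y. - (real k * \<epsilon>) < inf_sums y} \<in> sets seq_borel"
        using measurable_sets[OF measurable_inf_sums, of "{- (real k * \<epsilon>)<..}"]
        by (simp add: vimage_def space_PiM)
      have "measure (distr M seq_borel (\<lambda>\<omega> n. Y (Suc n) \<omega>)) {y. - (real k * \<epsilon>) < inf_sums y}
          = measure (distr M seq_borel (\<lambda>\<omega> n. Y n \<omega>)) {y. - (real k * \<epsilon>) < inf_sums y}"
        by (simp only: distr_shift)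
      then show ?thesis
        using measurable_steps iid_walk.measurable_steps[OF iid_walk_Suc]
        by (simp add: measure_distr I_def I'_def J_def vimage_def Int_def conj_commute)
    qed
    ultimately show ?thesis
      using k by simp
  qed
  have "AE \<omega> in M. Y 0 \<omega> \<le> 1 / real (Suc n)" for n
    using small[of "1 / real (Suc n)"]
    by (simp add: prob_eq_0 not_less)
  then have "AE \<omega> in M. \<forall>n. Y 0 \<omega> \<le> 1 / real (Suc n)"
    by (simp add: AE_all_countable)
  then have "AE \<omega> in M. 0 \<le> - Y 0 \<omega>"
  proof eventually_elim
    fix \<omega> assume *: "\<forall>n. Y 0 \<omega> \<le> 1 / real (Suc n)"
    show "0 \<le> - Y 0 \<omega>"
    proof (rule ccontr)
      assume "\<not> ?thesis"
      then obtain n where "inverse (real (Suc n)) < Y 0 \<omega>"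
        using reals_Archimedean[of "Y 0 \<omega>"] by auto
      then show False
        using *[rule_format, of n] by (simp add: inverse_eq_divide)
    qed
  qed
  then have "AE \<omega> in M. - Y 0 \<omega> = 0"
    using int mean by (subst integral_nonneg_eq_0_iff_AE[symmetric]) auto
  then show "AE \<omega> in M. Y 0 \<omega> = 0"
    by simp
qed

text \<open>Split at the first index \<open>j\<close> where the walk falls below \<open>- C\<close>.
  This depends on the steps before \<open>j\<close> only, so independently of it the block from
  \<open>j\<close> to \<open>v j\<close> rises by at most \<open>c\<close> with probability at least
  \<open>p\<close>. A separate later index \<open>v j\<close> for each \<open>j\<close> replaces the
  usual common endpoint, so the walk can be compared with its values on a coarser grid.\<close>

lemma ottaviani_inequality:
  fixes v :: "nat \<Rightarrow> nat"
  assumes v: "\<And>j. j \<le> v j" and p: "0 \<le> p"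
    and prob_ge: "\<And>j. j \<le> n \<Longrightarrow> p \<le> prob {\<omega>\<in>space M. (\<Sum>i\<in>{j..<v j}. Y i \<omega>) \<le> c}"
  shows "p * prob {\<omega>\<in>space M. \<exists>j\<le>n. (\<Sum>i<j. Y i \<omega>) < - C}
    \<le> prob {\<omega>\<in>space M. \<exists>j\<le>n. (\<Sum>i<v j. Y i \<omega>) < c - C}"
proof -
  define A where "A j = {\<omega>\<in>space M. (\<Sum>i<j. Y i \<omega>) < - C \<and> (\<forall>k<j. \<not> (\<Sum>i<k. Y i \<omega>) < - C)}" for j
  define G where "G j = {\<omega>\<in>space M. (\<Sum>i\<in>{j..<v j}. Y i \<omega>) \<le> c}" for j
  have [measurable]: "A j \<in> events" "G j \<in> events" for j
    unfolding A_def G_def by measurable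
  have disj: "disjoint_family A"
    unfolding disjoint_family_on_def A_def by (auto, metis nat_neq_iff)
  then have disjG: "disjoint_family (\<lambda>j. A j \<inter> G j)"
    unfolding disjoint_family_on_def by auto
  have first: "{\<omega>\<in>space M. \<exists>j\<le>n. (\<Sum>i<j. Y i \<omega>) < - C} = (\<Union>j\<in>{..n}. A j)"
  proof (intro equalityI subsetI)
    fix \<omega> assume "\<omega> \<in> {\<omega>\<in>space M. \<exists>j\<le>n. (\<Sum>i<j. Y i \<omega>) < - C}"
    then obtain j where \<omega>: "\<omega> \<in> space M" and j: "j \<le> n" "(\<Sum>i<j. Y i \<omega>) < - C"
      by auto
    define l where "l = (LEAST j. (\<Sum>i<j. Y i \<omega>) < - C)"
    have "l \<le> j" "(\<Sum>i<l. Y i \<omega>) < - C"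
      unfolding l_def using j(2) by (auto intro: Least_le LeastI[of _ j])
    moreover have "\<not> (\<Sum>i<k. Y i \<omega>) < - C" if "k < l" for k
      using that unfolding l_def by (rule not_less_Least)
    ultimately show "\<omega> \<in> (\<Union>j\<in>{..n}. A j)"
      using \<omega> j(1) by (auto simp: A_def intro!: bexI[of _ l])
  qed (auto simp: A_def)
  \<comment> \<open>Both events are rewritten as measurable sets of two disjoint blocks of
    coordinates, those before \<open>j\<close> and those from \<open>j\<close> on.\<close>
  have indep_AG: "prob (A j \<inter> G j) = prob (A j) * prob (G j)" for j
  proof -
    let ?SA = "{y \<in> space (PiM {..<j} (\<lambda>_. borel)). (\<Sum>i<j. y i) < - C \<and> (\<forall>k<j. \<not> (\<Sum>i<k. y i) < - C)} :: (nat \<Rightarrow> real) set"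
    let ?SG = "{y \<in> space (PiM {j..} (\<lambda>_. borel)). (\<Sum>i\<in>{j..<v j}. y i) \<le> c} :: (nat \<Rightarrow> real) set"
    have *: "(\<lambda>y. \<Sum>i<k. y i) \<in> borel_measurable (PiM {..<j} (\<lambda>_. borel :: real measure))" if "k \<le> j" for k
      using that by (intro borel_measurable_sum) auto
    have "{y \<in> space (PiM {..<j} (\<lambda>_. borel)). \<forall>k\<in>{..<j}. \<not> (\<Sum>i<k. y i :: real) < - C} \<in> sets (PiM {..<j} (\<lambda>_. borel))"
      using * by (intro sets.sets_Collect_finite_All sets.sets_Collect_neg) (auto intro!: borel_measurable_less)
    moreover have "{y \<in> space (PiM {..<j} (\<lambda>_. borel)). (\<Sum>i<j. y i :: real) < - C} \<in> sets (PiM {..<j} (\<lambda>_. borel))"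
      using *[of j] by measurable
    ultimately have SA: "?SA \<in> sets (PiM {..<j} (\<lambda>_. borel))"
      by (simp add: sets.sets_Collect_conj)
    have "(\<lambda>y. \<Sum>i\<in>{j..<v j}. y i) \<in> borel_measurable (PiM {j..} (\<lambda>_. borel :: real measure))"
      by (intro borel_measurable_sum) auto
    then have SG: "?SG \<in> sets (PiM {j..} (\<lambda>_. borel))"
      by measurable
    have "indep_var (PiM {..<j} (\<lambda>_. borel)) (\<lambda>\<omega>. restrict (\<lambda>i. Y i \<omega>) {..<j}) (PiM {j..} (\<lambda>_. borel)) (\<lambda>\<omega>. restrict (\<lambda>i. Y i \<omega>) {j..})"
      by (rule indep_var_restrict[OF indep]) auto
    from indep_varD[OF this SA SG] show ?thesis
      by (simp add: A_def G_def vimage_def Int_def space_PiM conj_ac cong: conj_cong)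
  qed
  have "p * prob {\<omega>\<in>space M. \<exists>j\<le>n. (\<Sum>i<j. Y i \<omega>) < - C} = (\<Sum>j\<le>n. p * prob (A j))"
    unfolding first using disj
    by (subst finite_measure_finite_Union) (auto simp: sum_distrib_left disjoint_family_on_def)
  also have "\<dots> \<le> (\<Sum>j\<le>n. prob (A j \<inter> G j))"
    unfolding indep_AG using prob_ge
    by (intro sum_mono, subst mult.commute) (auto simp: G_def intro!: mult_left_mono)
  also have "\<dots> = prob (\<Union>j\<in>{..n}. A j \<inter> G j)"
    using disjG by (subst finite_measure_finite_Union) (auto simp: disjoint_family_on_def)
  also have "\<dots> \<le> prob {\<omega>\<in>space M. \<exists>j\<le>n. (\<Sum>i<v j. Y i \<omega>) < c - C}"
  proof (rule finite_measure_mono)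
    show "(\<Union>j\<in>{..n}. A j \<inter> G j) \<subseteq> {\<omega>\<in>space M. \<exists>j\<le>n. (\<Sum>i<v j. Y i \<omega>) < c - C}"
    proof clarsimp
      fix \<omega> j assume "j \<le> n" "\<omega> \<in> A j" "\<omega> \<in> G j"
      moreover have "(\<Sum>i<v j. Y i \<omega>) = (\<Sum>i<j. Y i \<omega>) + (\<Sum>i\<in>{j..<v j}. Y i \<omega>)"
        using v[of j] by (simp add: lessThan_atLeast0 sum.atLeastLessThan_concat)
      ultimately show "\<omega> \<in> space M \<and> (\<exists>j\<le>n. (\<Sum>i<v j. Y i \<omega>) < c - C)"
        by (auto simp: A_def G_def intro!: exI[of _ j])
    qed
  qed measurable
  finally show ?thesis .
qed

text \<open>A quantitative form of the second Borel-Cantelli lemma: some bound \<open>K\<close>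
  holds for all steps with positive probability, which bounds the sum of the tail probabilities at
  the levels \<open>\<beta> * n + K\<close>. This sum controls the first moment.\<close>

lemma integrable_of_linear_growth:
  assumes \<beta>: "0 < \<beta>" and bound: "AE \<omega> in M. \<exists>K::nat. \<forall>n. \<bar>Y n \<omega>\<bar> \<le> \<beta> * real n + real K"
  shows "integrable M (Y 0)"
proof -
  define E where "E K = {\<omega>\<in>space M. \<forall>n. \<bar>Y n \<omega>\<bar> \<le> \<beta> * real n + real K}" for K :: nat
  have E_meas [measurable]: "E K \<in> events" for K
    unfolding E_def by measurable
  have "\<exists>K. prob (E K) \<noteq> 0"
  proof (rule ccontr)
    assume "\<nexists>K. prob (E K) \<noteq> 0"
    then have "AE \<omega> in M. \<omega> \<notin> E K" for K
      by (subst prob_eq_0[symmetric]) auto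
    then have "AE \<omega> in M. \<forall>K. \<omega> \<notin> E K"
      by (simp add: AE_all_countable)
    with bound AE_space have "AE \<omega> in M. False"
      by eventually_elim (auto simp: E_def)
    then show False by simp
  qed
  then obtain K where K: "prob (E K) > 0"
    by (auto simp: zero_less_measure_iff)
  define q where "q n = prob {\<omega>\<in>space M. \<beta> * real n + real K < \<bar>Y 0 \<omega>\<bar>}" for n
  have q_eq: "q n = prob {\<omega>\<in>space M. \<beta> * real n + real K < \<bar>Y n \<omega>\<bar>}" for n
  proof -
    have "measure (distr M borel (Y 0)) {x. \<beta> * real n + real K < \<bar>x\<bar>} = measure (distr M borel (Y n)) {x. \<beta> * real n + real K < \<bar>x\<bar>}"
      by (subst ident[of n]) simp
    then show ?thesis
      by (simp add: measure_distr q_def vimage_def Int_def conj_commute)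
  qed
  \<comment> \<open>By independence \<open>prob (E K)\<close> is at most the product of the factors
    \<open>1 - q n\<close>, each at most \<open>exp (- q n)\<close>. The case \<open>N = 0\<close>
    is separate because an intersection over no indices need not be an event.\<close>
  have sum_q: "(\<Sum>n<N. q n) \<le> - ln (prob (E K))" for N
  proof (cases "N = 0")
    case True
    then show ?thesis using K by simp
  next
    case False
    let ?A = "\<lambda>n. {x. \<bar>x\<bar> \<le> \<beta> * real n + real K}"
    have "prob (E K) \<le> prob (\<Inter>n\<in>{..<N}. Y n -` ?A n \<inter> space M)"
    proof (rule finite_measure_mono)
      show "E K \<subseteq> (\<Inter>n\<in>{..<N}. Y n -` ?A n \<inter> space M)"
        by (auto simp: E_def)
      show "(\<Inter>n\<in>{..<N}. Y n -` ?A n \<inter> space M) \<in> events"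
        using False by (intro sets.finite_INT measurable_sets[OF measurable_step]) auto
    qed
    also have "\<dots> = (\<Prod>n<N. prob (Y n -` ?A n \<inter> space M))"
      using False by (intro indep_varsD_finite[where M' = "\<lambda>_. borel"] indep_vars_subset[OF indep]) auto
    also have "\<dots> = (\<Prod>n<N. 1 - q n)"
    proof (rule prod.cong)
      fix n
      have "prob (space M - {\<omega>\<in>space M. \<beta> * real n + real K < \<bar>Y n \<omega>\<bar>}) = 1 - q n"
        unfolding q_eq by (rule prob_compl) measurable
      moreover have "space M - {\<omega>\<in>space M. \<beta> * real n + real K < \<bar>Y n \<omega>\<bar>} = Y n -` ?A n \<inter> space M"
        by auto
      ultimately show "prob (Y n -` ?A n \<inter> space M) = 1 - q n" by simp
    qed simp
    also have "\<dots> \<le> (\<Prod>n<N. exp (- q n))"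
      using exp_ge_add_one_self[of "- q _"] by (intro prod_mono) (auto simp: q_def)
    also have "\<dots> = exp (- (\<Sum>n<N. q n))"
      by (simp add: exp_sum sum_negf[symmetric])
    finally have "ln (prob (E K)) \<le> ln (exp (- (\<Sum>n<N. q n)))"
      using K by (subst ln_le_cancel_iff) auto
    then show ?thesis by simp
  qed
  \<comment> \<open>Above level \<open>K\<close>, each slab of height \<open>\<beta>\<close> is
    counted in full as soon as \<open>x\<close> exceeds its lower edge.\<close>
  have trunc: "min x (real K + \<beta> * real N) \<le> real K + \<beta> * (\<Sum>n<N. if \<beta> * real n + real K < x then 1 else 0)" for x N
  proof (induction N)
    case (Suc N)
    have "min x (real K + \<beta> * real (Suc N)) \<le> min x (real K + \<beta> * real N) + \<beta> * (if \<beta> * real N + real K < x then 1 else 0)"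
      using \<beta> by (auto simp: algebra_simps min_def)
    with Suc show ?case
      unfolding sum.lessThan_Suc distrib_left by linarith
  qed simp
  define L where "L = real K + \<beta> * (- ln (prob (E K)))"
  have trunc_le: "(\<integral>\<^sup>+\<omega>. ennreal (min \<bar>Y 0 \<omega>\<bar> (real K + \<beta> * real N)) \<partial>M) \<le> ennreal L" for N
  proof -
    let ?f = "\<lambda>n \<omega>. indicator {\<omega>\<in>space M. \<beta> * real n + real K < \<bar>Y 0 \<omega>\<bar>} \<omega> :: real"
    have "(\<integral>\<^sup>+\<omega>. ennreal (min \<bar>Y 0 \<omega>\<bar> (real K + \<beta> * real N)) \<partial>M)
        \<le> (\<integral>\<^sup>+\<omega>. ennreal (real K + \<beta> * (\<Sum>n<N. ?f n \<omega>)) \<partial>M)"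
    proof (intro nn_integral_mono ennreal_leI)
      fix \<omega> assume "\<omega> \<in> space M"
      then have "(\<Sum>n<N. ?f n \<omega>) = (\<Sum>n<N. if \<beta> * real n + real K < \<bar>Y 0 \<omega>\<bar> then 1 else 0)"
        by (intro sum.cong) auto
      then show "min \<bar>Y 0 \<omega>\<bar> (real K + \<beta> * real N) \<le> real K + \<beta> * (\<Sum>n<N. ?f n \<omega>)"
        using trunc[of "\<bar>Y 0 \<omega>\<bar>" N] by simp
    qed
    also have "\<dots> = ennreal (expectation (\<lambda>\<omega>. real K + \<beta> * (\<Sum>n<N. ?f n \<omega>)))"
      using \<beta> by (intro nn_integral_eq_integral AE_I2)
        (auto intro!: Bochner_Integration.integrable_sum integrable_real_indicator add_nonneg_nonneg mult_nonneg_nonneg sum_nonneg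
          simp: emeasure_eq_measure)
    also have "expectation (\<lambda>\<omega>. real K + \<beta> * (\<Sum>n<N. ?f n \<omega>)) = real K + \<beta> * (\<Sum>n<N. q n)"
      by (simp add: q_def prob_space emeasure_eq_measure Int_absorb2 Collect_restrict)
    also have "ennreal \<dots> \<le> ennreal L"
      unfolding L_def using sum_q[of N] \<beta> by (intro ennreal_leI add_left_mono mult_left_mono) auto
    finally show ?thesis .
  qed
  \<comment> \<open>The bound \<open>L\<close> is independent of \<open>N\<close> and the truncation
    is eventually inactive at each outcome, so Fatou's lemma removes it.\<close>
  have "(\<integral>\<^sup>+\<omega>. ennreal \<bar>Y 0 \<omega>\<bar> \<partial>M) = (\<integral>\<^sup>+\<omega>. liminf (\<lambda>N. ennreal (min \<bar>Y 0 \<omega>\<bar> (real K + \<beta> * real N))) \<partial>M)"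
  proof (rule nn_integral_cong)
    fix \<omega>
    obtain m :: nat where m: "\<bar>Y 0 \<omega>\<bar> / \<beta> < real m"
      using reals_Archimedean2 by blast
    have "min \<bar>Y 0 \<omega>\<bar> (real K + \<beta> * real N) = \<bar>Y 0 \<omega>\<bar>" if "N \<ge> m" for N
    proof -
      have "\<bar>Y 0 \<omega>\<bar> \<le> \<beta> * real m"
        using m \<beta> by (simp add: field_simps)
      also have "\<dots> \<le> \<beta> * real N"
        using \<beta> that by (intro mult_left_mono) auto
      finally show ?thesis by simp
    qed
    then have "eventually (\<lambda>N. ennreal (min \<bar>Y 0 \<omega>\<bar> (real K + \<beta> * real N)) = ennreal \<bar>Y 0 \<omega>\<bar>) sequentially"
      unfolding eventually_sequentially by (intro exI[of _ m]) simp
    then show "ennreal \<bar>Y 0 \<omega>\<bar> = liminf (\<lambda>N. ennreal (min \<bar>Y 0 \<omega>\<bar> (real K + \<beta> * real N)))"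
      by (intro lim_imp_Liminf[symmetric] tendsto_eventually) auto
  qed
  also have "\<dots> \<le> liminf (\<lambda>N. \<integral>\<^sup>+\<omega>. ennreal (min \<bar>Y 0 \<omega>\<bar> (real K + \<beta> * real N)) \<partial>M)"
    by (rule nn_integral_liminf) simp
  also have "\<dots> \<le> ennreal L"
    using trunc_le by (intro Liminf_le) auto
  finally show ?thesis
    by (intro integrableI_bounded) (auto intro: le_less_trans)
qed

end

section \<open>Sample paths\<close>

text \<open>The one-sided limits bound the path near every point, and bisection makes the bound
  uniform on the interval.\<close>

lemma cadlag_bounded:
  assumes f: "cadlag f" and ab: "a \<le> b"
  shows "\<exists>B. \<forall>s\<in>{a..b}. \<bar>f s\<bar> \<le> B"
proof (rule Bolzano[OF ab])
  fix a b c
  assume "\<exists>B. \<forall>s\<in>{a..b}. \<bar>f s\<bar> \<le> B" "\<exists>B. \<forall>s\<in>{b..c}. \<bar>f s\<bar> \<le> B"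
  then obtain B1 B2 where "\<forall>s\<in>{a..b}. \<bar>f s\<bar> \<le> B1" "\<forall>s\<in>{b..c}. \<bar>f s\<bar> \<le> B2"
    by auto
  then show "\<exists>B. \<forall>s\<in>{a..c}. \<bar>f s\<bar> \<le> B"
    by (intro exI[of _ "max B1 B2"]) (force simp: le_max_iff_disj)
next
  fix t
  obtain l where l: "(f \<longlongrightarrow> l) (at_left t)" and r: "(f \<longlongrightarrow> f t) (at_right t)"
    using f unfolding cadlag_def by blast
  define B where "B = max (\<bar>l\<bar> + 1) (\<bar>f t\<bar> + 1)"
  have "\<forall>\<^sub>F x in at_left t. \<bar>f x\<bar> \<le> B"
    using tendstoD[OF l, of 1] by (rule eventually_mono) (auto simp: B_def dist_real_def)
  moreover have "\<forall>\<^sub>F x in at_right t. \<bar>f x\<bar> \<le> B"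
    using tendstoD[OF r, of 1] by (rule eventually_mono) (auto simp: B_def dist_real_def)
  ultimately have "\<forall>\<^sub>F x in at t. \<bar>f x\<bar> \<le> B"
    by (simp add: eventually_at_split)
  then obtain d where d: "d > 0" "\<And>x. x \<noteq> t \<Longrightarrow> dist x t < d \<Longrightarrow> \<bar>f x\<bar> \<le> B"
    by (auto simp: eventually_at)
  have "\<bar>f x\<bar> \<le> B" if "dist x t < d" for x
    using d that by (cases "x = t") (auto simp: B_def)
  then show "\<exists>d>0. \<forall>a b. a \<le> t \<and> t \<le> b \<and> b - a < d \<longrightarrow> (\<exists>B. \<forall>s\<in>{a..b}. \<bar>f s\<bar> \<le> B)"
    using d(1) by (intro exI[of _ d]) (auto simp: dist_real_def intro!: exI[of _ B])
qed

section \<open>Minorants and linear lower bounds\<close>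

lemma is_lipschitz_minorant_bound:
  assumes "is_lipschitz_minorant \<alpha> f m"
  shows "m 0 - \<alpha> * \<bar>t\<bar> \<le> f t"
proof -
  have "dist (m t) (m 0) \<le> \<alpha> * dist t 0" "m t \<le> f t"
    using assms unfolding is_lipschitz_minorant_def lipschitz_on_def by blast+
  then show ?thesis
    by (simp add: dist_real_def)
qed

text \<open>The minorant is the infimal convolution of \<open>f\<close> with
  \<open>\<alpha> * \<bar>t\<bar>\<close>; the linear lower bound keeps the infimum finite.\<close>

lemma lipschitz_minorant_exists:
  assumes \<alpha>: "\<alpha> \<ge> 0" and bound: "\<And>t. C - \<alpha> * \<bar>t\<bar> \<le> f t"
  shows "\<exists>m. is_lipschitz_minorant \<alpha> f m"
proof -
  define m where "m t = (INF s. f s + \<alpha> * \<bar>t - s\<bar>)" for t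
  have bdd: "bdd_below (range (\<lambda>s. f s + \<alpha> * \<bar>t - s\<bar>))" for t
  proof (rule bdd_belowI2)
    fix s
    have "\<alpha> * \<bar>s\<bar> \<le> \<alpha> * (\<bar>t\<bar> + \<bar>t - s\<bar>)"
      using \<alpha> by (intro mult_left_mono) auto
    then show "C - \<alpha> * \<bar>t\<bar> \<le> f s + \<alpha> * \<bar>t - s\<bar>"
      using bound[of s] by (simp add: algebra_simps)
  qed
  have m_le: "m t \<le> f s + \<alpha> * \<bar>t - s\<bar>" for s t
    unfolding m_def using bdd by (rule cINF_lower) simp
  have m_step: "m t \<le> m u + \<alpha> * \<bar>t - u\<bar>" for t u
  proof -
    have "m t - \<alpha> * \<bar>t - u\<bar> \<le> f s + \<alpha> * \<bar>u - s\<bar>" for s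
    proof -
      have "\<alpha> * \<bar>t - s\<bar> \<le> \<alpha> * (\<bar>t - u\<bar> + \<bar>u - s\<bar>)"
        using \<alpha> by (intro mult_left_mono) auto
      then show ?thesis
        using m_le[of t s] by (simp add: algebra_simps)
    qed
    then have "m t - \<alpha> * \<bar>t - u\<bar> \<le> m u"
      unfolding m_def[of u] by (intro cINF_greatest) auto
    then show ?thesis by simp
  qed
  have "\<alpha>-lipschitz_on UNIV m"
  proof (rule lipschitz_onI)
    fix t u
    show "dist (m t) (m u) \<le> \<alpha> * dist t u"
      using m_step[of t u] m_step[of u t] by (auto simp: dist_real_def abs_minus_commute abs_le_iff)
  qed (rule \<alpha>)
  moreover have "m t \<le> f t" for t
    using m_le[of t t] by simp
  moreover have "g t \<le> m t" if g: "\<alpha>-lipschitz_on UNIV g" "\<forall>t. g t \<le> f t" for g t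
    unfolding m_def
  proof (rule cINF_greatest)
    fix s
    have "dist (g t) (g s) \<le> \<alpha> * dist t s" "g s \<le> f s"
      using g unfolding lipschitz_on_def by auto
    then show "g t \<le> f s + \<alpha> * \<bar>t - s\<bar>"
      by (simp add: dist_real_def)
  qed simp
  ultimately show ?thesis
    unfolding is_lipschitz_minorant_def by blast
qed

section \<open>Passage from dyadic times to all times\<close>

lemma dyadic_tendsto_from_right:
  fixes t :: real
  obtains z :: "nat \<Rightarrow> int" where "filterlim (\<lambda>k. of_int (z k) / 2 ^ k) (at_right t) sequentially"
proof
  \<comment> \<open>Floor plus one, unlike the ceiling, stays strictly to the right of
    \<open>t\<close> even when \<open>t\<close> is dyadic.\<close>
  define u where "u k = of_int (\<lfloor>t * 2 ^ k\<rfloor> + 1) / (2 ^ k :: real)" for k :: nat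
  have u: "t < u k" "u k \<le> t + 1 / 2 ^ k" for k
    unfolding u_def by (simp_all add: field_simps) linarith+
  have "(\<lambda>k. t + 1 / 2 ^ k) \<longlonglongrightarrow> t + 0"
    using LIMSEQ_realpow_zero[of "1 / 2"] by (intro tendsto_intros) (simp add: power_divide)
  then have "u \<longlonglongrightarrow> t"
    using u by (intro real_tendsto_sandwich[of "\<lambda>_. t" u sequentially "\<lambda>k. t + 1 / 2 ^ k"])
      (auto simp: less_imp_le)
  then show "filterlim u (at_right t) sequentially"
    using u by (auto simp: filterlim_at less_imp_neq[THEN not_sym])
qed

text \<open>There is one hypothesis per half-line because the two bounds come from separate walks,
  both indexed by natural numbers.\<close>

lemma cadlag_ge_of_dyadic:
  assumes f: "cadlag f"
    and pos: "\<And>k j :: nat. C - \<alpha> * (real j / 2 ^ k) \<le> f (real j / 2 ^ k)"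
    and neg: "\<And>k j :: nat. C - \<alpha> * (real j / 2 ^ k) \<le> f (- (real j / 2 ^ k))"
  shows "C - \<alpha> * \<bar>t\<bar> \<le> f t"
proof -
  have int: "C - \<alpha> * \<bar>of_int z / 2 ^ k\<bar> \<le> f (of_int z / 2 ^ k)" for z :: int and k :: nat
    using pos[of "nat z" k] neg[of "nat (- z)" k] by (cases "z \<ge> 0") auto
  obtain z :: "nat \<Rightarrow> int" where z: "filterlim (\<lambda>k. of_int (z k) / 2 ^ k) (at_right t) sequentially"
    by (rule dyadic_tendsto_from_right)
  have "(f \<longlongrightarrow> f t) (at_right t)"
    using f unfolding cadlag_def by blast
  then have "((\<lambda>s. f s + \<alpha> * \<bar>s\<bar>) \<longlongrightarrow> f t + \<alpha> * \<bar>t\<bar>) (at_right t)"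
    by (intro tendsto_intros)
  then have "(\<lambda>k. f (of_int (z k) / 2 ^ k) + \<alpha> * \<bar>of_int (z k) / 2 ^ k\<bar>) \<longlonglongrightarrow> f t + \<alpha> * \<bar>t\<bar>"
    using z by (rule filterlim_compose)
  moreover have "C \<le> f (of_int (z k) / 2 ^ k) + \<alpha> * \<bar>of_int (z k) / 2 ^ k\<bar>" for k
    using int[of "z k" k] by simp
  ultimately have "C \<le> f t + \<alpha> * \<bar>t\<bar>"
    by (intro LIMSEQ_le_const) auto
  then show ?thesis by simp
qed

lemma cadlag_eq_of_dyadic:
  assumes f: "cadlag f" and eq: "\<And>k z. f (of_int z / 2 ^ k) = c * (of_int z / 2 ^ k)"
  shows "f t = c * t"
proof -
  obtain z :: "nat \<Rightarrow> int" where z: "filterlim (\<lambda>k. of_int (z k) / 2 ^ k) (at_right t) sequentially"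
    by (rule dyadic_tendsto_from_right)
  have "(f \<longlongrightarrow> f t) (at_right t)"
    using f unfolding cadlag_def by blast
  then have "((\<lambda>s. f s - c * s) \<longlongrightarrow> f t - c * t) (at_right t)"
    by (intro tendsto_intros)
  then have "(\<lambda>k. f (of_int (z k) / 2 ^ k) - c * (of_int (z k) / 2 ^ k)) \<longlonglongrightarrow> f t - c * t"
    using z by (rule filterlim_compose)
  then have "(\<lambda>k. 0) \<longlonglongrightarrow> f t - c * t"
    by (simp add: eq)
  then show ?thesis
    by (simp add: tendsto_const_iff)
qed

section \<open>Increments of a Levy process\<close>

context two_sided_levy_process
begin

declare measurable_X [measurable]

section \<open>Increments over the cells of a grid\<close>

definition step :: "real \<Rightarrow> int \<Rightarrow> 'w \<Rightarrow> real" where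
  "step h z \<omega> = X (of_int (z + 1) * h) \<omega> - X (of_int z * h) \<omega>"

lemma measurable_step [measurable]: "step h z \<in> borel_measurable M"
  unfolding step_def[abs_def] by measurable

text \<open>Induction on the largest index: the increments over earlier cells are measurable with
  respect to the path up to the start of the last cell, and the increment over that cell is
  independent of this past.\<close>

lemma indep_vars_step:
  assumes h: "h > 0"
  shows "indep_vars (\<lambda>_. borel) (step h) UNIV"
  unfolding indep_vars_def2
proof (intro conjI ballI indep_setsI)
  fix A :: "int \<Rightarrow> 'w set" and J :: "int set"
  assume "finite J" "J \<noteq> {}" and A: "\<forall>j\<in>J. A j \<in> {step h j -` B \<inter> space M |B. B \<in> sets borel}"
  then show "prob (\<Inter>j\<in>J. A j) = (\<Prod>j\<in>J. prob (A j))"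
  proof (induction J rule: finite_linorder_max_induct)
    case (insert b J)
    show ?case
    proof (cases "J = {}")
      case False
      define P where "P = {X r -` B \<inter> space M |r B. r \<le> of_int b * h \<and> B \<in> sets borel}"
      define F where "F = sigma (space M) P"
      have P: "P \<subseteq> Pow (space M)"
        by (auto simp: P_def)
      have X_F: "X r \<in> borel_measurable F" if "r \<le> of_int b * h" for r
      proof (rule measurableI)
        fix B :: "real set" assume "B \<in> sets borel"
        then have "X r -` B \<inter> space M \<in> P"
          using that by (auto simp: P_def)
        then show "X r -` B \<inter> space F \<in> sets F"
          using P by (simp add: F_def space_measure_of sets_measure_of)
      qed simp
      have "A j \<in> sets F" if "j \<in> J" for j
      proof -
        have "A j \<in> {step h j -` B \<inter> space M |B. B \<in> sets borel}"
          using insert.prems that by blast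
        then obtain B where B: "B \<in> sets borel" "A j = step h j -` B \<inter> space M"
          by blast
        have "of_int (j + 1) * h \<le> of_int b * h" "of_int j * h \<le> of_int b * h"
          using insert.hyps(2) that h by (auto intro!: mult_right_mono simp del: of_int_add)
        then have "step h j \<in> borel_measurable F"
          unfolding step_def[abs_def] by (intro borel_measurable_diff X_F)
        from measurable_sets[OF this B(1)] show ?thesis
          using P by (simp add: B(2) F_def space_measure_of)
      qed
      then have "(\<Inter>j\<in>J. A j) \<in> sets F"
        using insert.hyps(1) False by (intro sets.finite_INT) auto
      then have past: "(\<Inter>j\<in>J. A j) \<in> sigma_sets (space M) P"
        using P by (simp add: F_def sets_measure_of)
      have "of_int b * h < of_int (b + 1) * h"
        using h by (simp add: algebra_simps)
      note indep = indep_increment[OF this]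
      have "A b \<in> {(\<lambda>\<omega>. X (of_int (b + 1) * h) \<omega> - X (of_int b * h) \<omega>) -` B \<inter> space M |B. B \<in> sets borel}"
        using insert.prems by (simp add: step_def[abs_def])
      from indep_setD[OF indep this past[unfolded P_def]]
      have "prob (A b \<inter> (\<Inter>j\<in>J. A j)) = prob (A b) * prob (\<Inter>j\<in>J. A j)" .
      moreover have "b \<notin> J"
        using insert.hyps(2) by auto
      ultimately show ?thesis
        using insert False by simp
    qed simp
  qed simp
qed auto

text \<open>
  The sign \<open>\<epsilon>\<close> selects the half-line. For \<open>\<epsilon> = -1\<close> the increments in \<open>t\<close>, up to the drift \<open>c\<close>, have the
  law of those of \<open>- X\<close>, not of \<open>X\<close>.
\<close>

definition drifted :: "real \<Rightarrow> real \<Rightarrow> real \<Rightarrow> 'w \<Rightarrow> real" where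
  "drifted \<epsilon> c t \<omega> = X (\<epsilon> * t) \<omega> + c * t"

lemma measurable_drifted [measurable]: "drifted \<epsilon> c t \<in> borel_measurable M"
  unfolding drifted_def[abs_def] by measurable

lemma distr_drifted_diff:
  assumes \<epsilon>: "\<epsilon> = 1 \<or> \<epsilon> = -1" and st: "s < t"
  shows "distr M borel (\<lambda>\<omega>. drifted \<epsilon> c t \<omega> - drifted \<epsilon> c s \<omega>)
    = distr M borel (\<lambda>\<omega>. \<epsilon> * X (t - s) \<omega> + c * (t - s))"
proof -
  \<comment> \<open>The left end of the interval in the time of \<open>X\<close>. For
    \<open>\<epsilon> = -1\<close> the interval from \<open>s\<close> to \<open>t\<close> is
    reflected, so it starts at \<open>- t\<close> and the increment changes sign.\<close>
  define u where "u = (if \<epsilon> = 1 then s else - t)"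
  have inc: "distr M borel (\<lambda>\<omega>. X (u + (t - s)) \<omega> - X u \<omega>) = distr M borel (X (t - s))"
    using stationary_increment[of u "u + (t - s)"] st by simp
  have "(\<lambda>\<omega>. drifted \<epsilon> c t \<omega> - drifted \<epsilon> c s \<omega>) = (\<lambda>\<omega>. \<epsilon> * (X (u + (t - s)) \<omega> - X u \<omega>) + c * (t - s))"
    using \<epsilon> by (auto simp: drifted_def u_def fun_eq_iff algebra_simps)
  then have "distr M borel (\<lambda>\<omega>. drifted \<epsilon> c t \<omega> - drifted \<epsilon> c s \<omega>)
    = distr M borel (\<lambda>\<omega>. \<epsilon> * (X (u + (t - s)) \<omega> - X u \<omega>) + c * (t - s))"
    by (rule arg_cong)
  also have "\<dots> = distr (distr M borel (\<lambda>\<omega>. X (u + (t - s)) \<omega> - X u \<omega>)) borel (\<lambda>x. \<epsilon> * x + c * (t - s))"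
    by (subst distr_distr) (auto simp: comp_def)
  also have "\<dots> = distr M borel (\<lambda>\<omega>. \<epsilon> * X (t - s) \<omega> + c * (t - s))"
    unfolding inc by (subst distr_distr) (auto simp: comp_def)
  finally show ?thesis .
qed

section \<open>Walks along the two half-lines\<close>

definition walk :: "real \<Rightarrow> real \<Rightarrow> real \<Rightarrow> nat \<Rightarrow> 'w \<Rightarrow> real" where
  "walk \<epsilon> c h n \<omega> = drifted \<epsilon> c (real (Suc n) * h) \<omega> - drifted \<epsilon> c (real n * h) \<omega>"

lemma sum_walk:
  assumes "\<omega> \<in> space M"
  shows "(\<Sum>i<n. walk \<epsilon> c h i \<omega>) = drifted \<epsilon> c (real n * h) \<omega>"
  unfolding walk_def by (subst sum_lessThan_telescope) (simp add: drifted_def X_zero assms)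

lemma distr_walk:
  assumes "\<epsilon> = 1 \<or> \<epsilon> = -1" "0 < h"
  shows "distr M borel (walk \<epsilon> c h n) = distr M borel (\<lambda>\<omega>. \<epsilon> * X h \<omega> + c * h)"
  using distr_drifted_diff[of \<epsilon> "real n * h" "real (Suc n) * h" c] assms
  by (simp add: walk_def[abs_def] algebra_simps)

lemma iid_walk_walk:
  assumes \<epsilon>: "\<epsilon> = 1 \<or> \<epsilon> = -1" and h: "0 < h"
  shows "iid_walk M (walk \<epsilon> c h)"
proof
  \<comment> \<open>On the negative half-line the step with number \<open>n\<close> spans the cell
    from \<open>- (n + 1) * h\<close> to \<open>- n * h\<close>, whose index is
    \<open>- n - 1\<close>.\<close>
  define f :: "nat \<Rightarrow> int" where "f n = (if \<epsilon> = 1 then int n else - int n - 1)" for n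
  have "inj f"
    by (auto simp: f_def inj_on_def)
  then have "indep_vars (\<lambda>_. borel) (\<lambda>n. step h (f n)) UNIV"
    using indep_vars_reindex[OF indep_vars_step[OF h], of f UNIV] by simp
  then have "indep_vars (\<lambda>_. borel) (\<lambda>n \<omega>. \<epsilon> * step h (f n) \<omega> + c * h) UNIV"
    by (rule indep_vars_compose2[where Y = "\<lambda>_ x. \<epsilon> * x + c * h"]) auto
  moreover have "(\<lambda>n \<omega>. \<epsilon> * step h (f n) \<omega> + c * h) = walk \<epsilon> c h"
  proof (intro ext)
    fix n \<omega>
    have "of_int (f n + 1) * h = (if \<epsilon> = 1 then real (Suc n) * h else \<epsilon> * (real n * h))"
      "of_int (f n) * h = (if \<epsilon> = 1 then real n * h else \<epsilon> * (real (Suc n) * h))"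
      using \<epsilon> by (auto simp: f_def algebra_simps)
    then show "\<epsilon> * step h (f n) \<omega> + c * h = walk \<epsilon> c h n \<omega>"
      using \<epsilon> unfolding step_def walk_def drifted_def by (auto simp: algebra_simps)
  qed
  ultimately show "indep_vars (\<lambda>_. borel) (walk \<epsilon> c h) UNIV"
    by simp
  show "distr M borel (walk \<epsilon> c h n) = distr M borel (walk \<epsilon> c h 0)" for n
    using distr_walk[OF assms] by simp
qed

lemma
  assumes \<epsilon>: "\<epsilon> = 1 \<or> \<epsilon> = -1"
  shows integrable_walk: "integrable M (walk \<epsilon> c 1 0) \<longleftrightarrow> integrable M (X 1)"
    and expectation_walk: "integrable M (X 1) \<Longrightarrow> expectation (walk \<epsilon> c 1 0) = \<epsilon> * expectation (X 1) + c"
proof -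
  interpret iid_walk M "walk \<epsilon> c 1"
    using \<epsilon> by (rule iid_walk_walk) simp
  note eq = distr_walk[OF \<epsilon>, of 1 c 0, simplified]
  have "integrable M (walk \<epsilon> c 1 0) \<longleftrightarrow> integrable (distr M borel (walk \<epsilon> c 1 0)) (\<lambda>x. x)"
    by (simp add: integrable_distr_eq)
  also have "\<dots> \<longleftrightarrow> integrable M (\<lambda>\<omega>. \<epsilon> * X 1 \<omega> + c)"
    unfolding eq by (simp add: integrable_distr_eq)
  also have "\<dots> \<longleftrightarrow> integrable M (X 1)"
  proof
    assume "integrable M (\<lambda>\<omega>. \<epsilon> * X 1 \<omega> + c)"
    \<comment> \<open>The sign \<open>\<epsilon>\<close> is its own inverse.\<close>
    then have "integrable M (\<lambda>\<omega>. \<epsilon> * ((\<epsilon> * X 1 \<omega> + c) - c))"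
      by (intro Bochner_Integration.integrable_mult_right Bochner_Integration.integrable_diff) auto
    then show "integrable M (X 1)"
      using \<epsilon> by auto
  qed auto
  finally show "integrable M (walk \<epsilon> c 1 0) \<longleftrightarrow> integrable M (X 1)" .
  assume int: "integrable M (X 1)"
  have "expectation (walk \<epsilon> c 1 0) = (\<integral>x. x \<partial>distr M borel (walk \<epsilon> c 1 0))"
    by (simp add: integral_distr)
  also have "\<dots> = expectation (\<lambda>\<omega>. \<epsilon> * X 1 \<omega> + c)"
    unfolding eq by (simp add: integral_distr)
  also have "\<dots> = \<epsilon> * expectation (X 1) + c"
    using int by (simp add: prob_space)
  finally show "expectation (walk \<epsilon> c 1 0) = \<epsilon> * expectation (X 1) + c" .
qed

section \<open>Lower bounds at integer and at dyadic times\<close>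

lemma AE_drifted_bdd_below_nat:
  assumes "\<epsilon> = 1 \<or> \<epsilon> = -1" "integrable M (X 1)" "0 < \<epsilon> * expectation (X 1) + c"
  shows "AE \<omega> in M. \<exists>C::nat. \<forall>n::nat. - real C \<le> drifted \<epsilon> c (real n) \<omega>"
proof -
  interpret iid_walk M "walk \<epsilon> c 1"
    using assms(1) by (rule iid_walk_walk) simp
  have "AE \<omega> in M. sums_bdd_below (\<lambda>n. walk \<epsilon> c 1 n \<omega>)"
    using assms by (intro sums_bdd_below_AE) (auto simp: integrable_walk expectation_walk)
  with AE_space show ?thesis
    by eventually_elim (simp add: sums_bdd_below_def sum_walk)
qed

text \<open>Paths are bounded on the unit interval, so some bound holds there with probability above
  1/2, and stationarity carries it to every interval of length at most 1. Restricting to rational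
  lags keeps \<open>E k\<close> a countable intersection, hence an event.\<close>

lemma tight_drifted:
  assumes \<epsilon>: "\<epsilon> = 1 \<or> \<epsilon> = -1" and c: "0 \<le> c"
  shows "\<exists>K. \<forall>s t. s \<le> t \<and> t - s \<le> 1 \<and> t - s \<in> \<rat> \<longrightarrow>
    1 / 2 \<le> prob {\<omega>\<in>space M. drifted \<epsilon> c t \<omega> - drifted \<epsilon> c s \<omega> \<le> K}"
proof -
  define E where "E k = {\<omega>\<in>space M. \<forall>q\<in>\<rat> \<inter> {0..1}. \<bar>X q \<omega>\<bar> \<le> real k}" for k :: nat
  have [measurable]: "E k \<in> events" for k
    unfolding E_def by (intro sets.sets_Collect_countable_All') (auto intro: countable_Int1 countable_rat)
  have "(\<lambda>k. prob (E k)) \<longlonglongrightarrow> prob (\<Union>k. E k)"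
  proof (rule finite_Lim_measure_incseq)
    show "incseq E"
    proof (rule incseq_SucI)
      show "E k \<subseteq> E (Suc k)" for k
        by (auto simp: E_def intro: order_trans[of _ "real k"])
    qed
  qed auto
  also have "(\<Union>k. E k) = space M"
  proof (intro equalityI subsetI)
    fix \<omega> assume \<omega>: "\<omega> \<in> space M"
    have "\<exists>B. \<forall>s\<in>{0..1}. \<bar>X s \<omega>\<bar> \<le> B"
      using cadlag_paths[OF \<omega>] by (rule cadlag_bounded) simp
    then obtain B where B: "\<forall>s\<in>{0..1}. \<bar>X s \<omega>\<bar> \<le> B"
      by blast
    obtain k :: nat where k: "B \<le> real k"
      using real_arch_simple by blast
    have "\<bar>X q \<omega>\<bar> \<le> real k" if "q \<in> \<rat> \<inter> {0..1}" for q
      using B k that by (meson IntD2 order_trans)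
    then have "\<omega> \<in> E k"
      using \<omega> by (simp add: E_def)
    then show "\<omega> \<in> (\<Union>k. E k)"
      by blast
  qed (auto simp: E_def)
  finally have "\<forall>\<^sub>F k in sequentially. 1 / 2 < prob (E k)"
    by (intro order_tendstoD(1)) (auto simp: prob_space)
  then obtain k where k: "1 / 2 < prob (E k)"
    by (auto simp: eventually_sequentially)
  show ?thesis
  \<comment> \<open>The summand \<open>c\<close> covers the drift over a time of at most 1.\<close>
  proof (intro exI[of _ "real k + c"] allI impI)
    fix s t :: real assume st: "s \<le> t \<and> t - s \<le> 1 \<and> t - s \<in> \<rat>"
    show "1 / 2 \<le> prob {\<omega>\<in>space M. drifted \<epsilon> c t \<omega> - drifted \<epsilon> c s \<omega> \<le> real k + c}"
    proof (cases "s = t")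
      case True
      then show ?thesis using c by (simp add: prob_space)
    next
      case False
      with st have "s < t" by simp
      have "E k \<subseteq> {\<omega>\<in>space M. \<epsilon> * X (t - s) \<omega> + c * (t - s) \<le> real k + c}"
      proof
        fix \<omega> assume \<omega>: "\<omega> \<in> E k"
        then have "\<bar>X (t - s) \<omega>\<bar> \<le> real k"
          using st by (auto simp: E_def)
        moreover have "c * (t - s) \<le> c"
          using c st by (simp add: mult_left_le)
        ultimately show "\<omega> \<in> {\<omega>\<in>space M. \<epsilon> * X (t - s) \<omega> + c * (t - s) \<le> real k + c}"
          using \<epsilon> \<omega> by (auto simp: E_def)
      qed
      then have "prob (E k) \<le> prob {\<omega>\<in>space M. \<epsilon> * X (t - s) \<omega> + c * (t - s) \<le> real k + c}"
        by (rule finite_measure_mono) measurable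
      also have "\<dots> = measure (distr M borel (\<lambda>\<omega>. \<epsilon> * X (t - s) \<omega> + c * (t - s))) {..real k + c}"
        by (subst measure_distr) (auto simp: vimage_def Int_def conj_commute)
      also have "\<dots> = prob {\<omega>\<in>space M. drifted \<epsilon> c t \<omega> - drifted \<epsilon> c s \<omega> \<le> real k + c}"
        unfolding distr_drifted_diff[OF \<epsilon> \<open>s < t\<close>, symmetric]
        by (subst measure_distr) (auto simp: vimage_def Int_def conj_commute)
      finally show ?thesis
        using k by simp
    qed
  qed
qed

text \<open>Ottaviani's inequality compares the grid of mesh \<open>1 / 2 ^ k\<close> with the
  integers: going below \<open>- C\<close> on the grid is at most twice as likely as going below
  \<open>K - C\<close> at an integer. The tightness constant \<open>K\<close> serves all meshes, and
  the integer probability tends to 0 as \<open>C\<close> grows.\<close>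

lemma AE_drifted_bdd_below_dyadic:
  assumes \<epsilon>: "\<epsilon> = 1 \<or> \<epsilon> = -1" and c: "0 \<le> c"
    and int: "integrable M (X 1)" and pos: "0 < \<epsilon> * expectation (X 1) + c"
  shows "AE \<omega> in M. \<exists>C::nat. \<forall>k j :: nat. - real C \<le> drifted \<epsilon> c (real j / 2 ^ k) \<omega>"
proof -
  obtain K where K: "\<And>s t. s \<le> t \<Longrightarrow> t - s \<le> 1 \<Longrightarrow> t - s \<in> \<rat> \<Longrightarrow>
      1 / 2 \<le> prob {\<omega>\<in>space M. drifted \<epsilon> c t \<omega> - drifted \<epsilon> c s \<omega> \<le> K}"
    using tight_drifted[OF \<epsilon> c] by blast
  define D where "D C k = {\<omega>\<in>space M. \<exists>j::nat. drifted \<epsilon> c (real j / 2 ^ k) \<omega> < - real C}" for C k :: nat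
  define N where "N C = {\<omega>\<in>space M. \<exists>i::nat. drifted \<epsilon> c (real i) \<omega> < K - real C}" for C :: nat
  have [measurable]: "D C k \<in> events" "N C \<in> events" for C k
    unfolding D_def N_def by measurable
  have D_le: "1 / 2 * prob (D C k) \<le> prob (N C)" for C k
  proof -
    define h :: real where "h = 1 / 2 ^ k"
    interpret iid_walk M "walk \<epsilon> c h"
      using \<epsilon> by (rule iid_walk_walk) (simp add: h_def)
    \<comment> \<open>\<open>v j\<close> rounds \<open>j\<close> up to a multiple of
      \<open>2 ^ k\<close>, so \<open>v j * h\<close> is the first integer time not before
      \<open>j * h\<close>, less than 1 later.\<close>
    define v :: "nat \<Rightarrow> nat" where "v j = ((j + 2 ^ k - 1) div 2 ^ k) * 2 ^ k" for j
    have v: "j \<le> v j" "v j < j + 2 ^ k" for j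
    proof -
      have "(j + 2 ^ k - 1) div 2 ^ k * 2 ^ k + (j + 2 ^ k - 1) mod 2 ^ k = j + 2 ^ k - 1"
        by (rule div_mult_mod_eq)
      moreover have "(j + 2 ^ k - 1) mod 2 ^ k < (2 ^ k :: nat)"
        by simp
      moreover have "(1::nat) \<le> 2 ^ k"
        by simp
      ultimately show "j \<le> v j" "v j < j + 2 ^ k"
        unfolding v_def by linarith+
    qed
    have vh: "real (v j) * h = real ((j + 2 ^ k - 1) div 2 ^ k)" for j
      by (simp add: v_def h_def)
    \<comment> \<open>The inequality is applied on a finite horizon \<open>n\<close>, which then
      grows to infinity. The walk at index \<open>v j\<close> is at an integer time, so the event on
      the right lies in \<open>N C\<close>.\<close>
    have bound: "1 / 2 * prob {\<omega>\<in>space M. \<exists>j\<le>n. drifted \<epsilon> c (real j * h) \<omega> < - real C} \<le> prob (N C)" for n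
    proof -
      have "1 / 2 * prob {\<omega>\<in>space M. \<exists>j\<le>n. (\<Sum>i<j. walk \<epsilon> c h i \<omega>) < - real C}
        \<le> prob {\<omega>\<in>space M. \<exists>j\<le>n. (\<Sum>i<v j. walk \<epsilon> c h i \<omega>) < K - real C}"
      proof (rule ottaviani_inequality)
        fix j
        have "real j * h \<le> real (v j) * h"
          using v(1)[of j] by (intro mult_right_mono) (auto simp: h_def)
        moreover have "real (v j) * h - real j * h \<le> 1"
        proof -
          have "real (v j) \<le> real j + 2 ^ k"
            using v(2)[of j] by (metis less_imp_le of_nat_add of_nat_le_iff of_nat_numeral of_nat_power)
          then show ?thesis
            by (simp add: h_def field_simps)
        qed
        moreover have "real (v j) * h - real j * h \<in> \<rat>"
          by (simp add: h_def)
        ultimately have "1 / 2 \<le> prob {\<omega>\<in>space M. drifted \<epsilon> c (real (v j) * h) \<omega> - drifted \<epsilon> c (real j * h) \<omega> \<le> K}"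
          by (rule K)
        also have "{\<omega>\<in>space M. drifted \<epsilon> c (real (v j) * h) \<omega> - drifted \<epsilon> c (real j * h) \<omega> \<le> K}
            = {\<omega>\<in>space M. (\<Sum>i\<in>{j..<v j}. walk \<epsilon> c h i \<omega>) \<le> K}"
        proof -
          have "(\<Sum>i\<in>{j..<v j}. walk \<epsilon> c h i \<omega>) = drifted \<epsilon> c (real (v j) * h) \<omega> - drifted \<epsilon> c (real j * h) \<omega>" for \<omega>
            unfolding walk_def using v(1)[of j] by (rule sum_Suc_diff')
          then show ?thesis by simp
        qed
        finally show "1 / 2 \<le> prob {\<omega>\<in>space M. (\<Sum>i\<in>{j..<v j}. walk \<epsilon> c h i \<omega>) \<le> K}" .
      qed (use v in auto)
      also have "{\<omega>\<in>space M. \<exists>j\<le>n. (\<Sum>i<j. walk \<epsilon> c h i \<omega>) < - real C}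
          = {\<omega>\<in>space M. \<exists>j\<le>n. drifted \<epsilon> c (real j * h) \<omega> < - real C}"
        by (auto simp: sum_walk)
      also have "prob {\<omega>\<in>space M. \<exists>j\<le>n. (\<Sum>i<v j. walk \<epsilon> c h i \<omega>) < K - real C} \<le> prob (N C)"
        by (rule finite_measure_mono) (auto simp: N_def sum_walk vh)
      finally show ?thesis .
    qed
    have "(\<lambda>n. 1 / 2 * prob {\<omega>\<in>space M. \<exists>j\<le>n. drifted \<epsilon> c (real j * h) \<omega> < - real C})
        \<longlonglongrightarrow> 1 / 2 * prob (\<Union>n. {\<omega>\<in>space M. \<exists>j\<le>n. drifted \<epsilon> c (real j * h) \<omega> < - real C})"
    proof (intro tendsto_intros finite_Lim_measure_incseq)
      show "range (\<lambda>n. {\<omega>\<in>space M. \<exists>j\<le>n. drifted \<epsilon> c (real j * h) \<omega> < - real C}) \<subseteq> events"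
        by auto
      show "incseq (\<lambda>n. {\<omega>\<in>space M. \<exists>j\<le>n. drifted \<epsilon> c (real j * h) \<omega> < - real C})"
        by (auto simp: incseq_def intro: le_trans)
    qed
    moreover have "(\<Union>n. {\<omega>\<in>space M. \<exists>j\<le>n. drifted \<epsilon> c (real j * h) \<omega> < - real C}) = D C k"
      by (auto simp: D_def h_def)
    ultimately have "(\<lambda>n. 1 / 2 * prob {\<omega>\<in>space M. \<exists>j\<le>n. drifted \<epsilon> c (real j * h) \<omega> < - real C})
        \<longlonglongrightarrow> 1 / 2 * prob (D C k)"
      by simp
    then show ?thesis
      by (rule LIMSEQ_le_const2) (use bound in blast)
  qed
  \<comment> \<open>The dyadic grids are nested, so the uniform bound passes to the union over all
    meshes.\<close>
  have D_Suc: "D C k \<subseteq> D C (Suc k)" for C k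
  proof
    fix \<omega> assume "\<omega> \<in> D C k"
    then obtain j :: nat where j: "\<omega> \<in> space M" "drifted \<epsilon> c (real j / 2 ^ k) \<omega> < - real C"
      by (auto simp: D_def)
    moreover have "real j / 2 ^ k = real (2 * j) / 2 ^ Suc k"
      by simp
    ultimately show "\<omega> \<in> D C (Suc k)"
      unfolding D_def by (metis (mono_tags, lifting) mem_Collect_eq)
  qed
  have UD_le: "1 / 2 * prob (\<Union>k. D C k) \<le> prob (N C)" for C
  proof -
    have "(\<lambda>k. 1 / 2 * prob (D C k)) \<longlonglongrightarrow> 1 / 2 * prob (\<Union>k. D C k)"
      using D_Suc by (intro tendsto_intros finite_Lim_measure_incseq incseq_SucI) auto
    then show ?thesis
      using D_le by (intro LIMSEQ_le_const2[of _ _ "prob (N C)"]) auto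
  qed
  \<comment> \<open>The limit is 0 because the integer walk is almost surely bounded below.\<close>
  have "(\<lambda>C. prob (N C)) \<longlonglongrightarrow> prob (\<Inter>C. N C)"
  proof (rule finite_Lim_measure_decseq)
    show "decseq N"
    proof (rule decseq_SucI)
      fix C show "N (Suc C) \<subseteq> N C"
      proof
        fix \<omega> assume "\<omega> \<in> N (Suc C)"
        then obtain i :: nat where "\<omega> \<in> space M" "drifted \<epsilon> c (real i) \<omega> < K - real (Suc C)"
          by (auto simp: N_def)
        moreover from this(2) have "drifted \<epsilon> c (real i) \<omega> < K - real C"
          by simp
        ultimately show "\<omega> \<in> N C"
          by (auto simp: N_def intro!: exI[of _ i])
      qed
    qed
  qed auto
  moreover have "AE \<omega> in M. \<omega> \<notin> (\<Inter>C. N C)"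
    using AE_drifted_bdd_below_nat[OF \<epsilon> int pos]
  proof eventually_elim
    case (elim \<omega>)
    then obtain C :: nat where C: "\<And>n. - real C \<le> drifted \<epsilon> c (real n) \<omega>"
      by auto
    obtain m :: nat where m: "K + real C \<le> real m"
      using real_arch_simple by blast
    have "\<omega> \<notin> N m"
      using C m by (auto simp: N_def not_less intro: order_trans[of _ "- real C"])
    then show ?case by auto
  qed
  then have "prob (\<Inter>C. N C) = 0"
    by (subst prob_eq_0) auto
  ultimately have "(\<lambda>C. prob (N C)) \<longlonglongrightarrow> 0"
    by simp
  moreover have "1 / 2 * prob (\<Inter>C. \<Union>k. D C k) \<le> prob (N C)" for C
  proof -
    have "prob (\<Inter>C. \<Union>k. D C k) \<le> prob (\<Union>k. D C k)"
      by (rule finite_measure_mono) auto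
    then show ?thesis
      using UD_le[of C] by simp
  qed
  ultimately have "1 / 2 * prob (\<Inter>C. \<Union>k. D C k) \<le> 0"
    by (intro LIMSEQ_le_const) auto
  then have "prob (\<Inter>C. \<Union>k. D C k) = 0"
    by (simp add: measure_le_0_iff)
  then have "AE \<omega> in M. \<omega> \<notin> (\<Inter>C. \<Union>k. D C k)"
    by (subst (asm) prob_eq_0) auto
  with AE_space show ?thesis
    by eventually_elim (auto simp: D_def not_less)
qed

end

section \<open>Degenerate characteristic exponents\<close>

text \<open>Small jumps are controlled by the second order Taylor bound and large jumps by the
  trivial bound 2. Integrability allows the real part to be taken under the integral, which would
  otherwise have a default value.\<close>

lemma integrable_levy_exponent:
  assumes \<nu>: "levy_measure \<nu>"
  shows "integrable \<nu> (\<lambda>x. 1 - iexp (\<theta> * x) + \<i> * of_real (\<theta> * x * indicator {x. \<bar>x\<bar> < 1} x))"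
proof -
  have [measurable_cong]: "sets \<nu> = sets borel"
    using \<nu> by (simp add: levy_measure_def)
  have "integrable \<nu> (\<lambda>x. min 1 (x\<^sup>2))"
    using \<nu> by (intro integrableI_nonneg) (auto simp: levy_measure_def)
  then have "integrable \<nu> (\<lambda>x. (2 + \<theta>\<^sup>2) * min 1 (x\<^sup>2))"
    by simp
  then show ?thesis
  proof (rule Bochner_Integration.integrable_bound)
    show "AE x in \<nu>. norm (1 - iexp (\<theta> * x) + \<i> * of_real (\<theta> * x * indicator {x. \<bar>x\<bar> < 1} x))
        \<le> norm ((2 + \<theta>\<^sup>2) * min 1 (x\<^sup>2))"
    proof (rule AE_I2)
      fix x :: real
      show "norm (1 - iexp (\<theta> * x) + \<i> * of_real (\<theta> * x * indicator {x. \<bar>x\<bar> < 1} x))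
        \<le> norm ((2 + \<theta>\<^sup>2) * min 1 (x\<^sup>2))"
      proof (cases "\<bar>x\<bar> < 1")
        case True
        have "norm (1 - iexp (\<theta> * x) + \<i> * of_real (\<theta> * x)) = norm (iexp (\<theta> * x) - (\<Sum>k\<le>1. (\<i> * (\<theta> * x)) ^ k / fact k))"
          by (simp add: norm_minus_commute algebra_simps)
        also have "\<dots> \<le> \<bar>\<theta> * x\<bar> ^ 2 / 2"
          using iexp_approx1[of "\<theta> * x" 1] by (simp add: numeral_2_eq_2)
        also have "\<dots> \<le> (2 + \<theta>\<^sup>2) * x\<^sup>2"
          by (simp add: power_mult_distrib distrib_right)
        also have "\<dots> = norm ((2 + \<theta>\<^sup>2) * min 1 (x\<^sup>2))"
          using True abs_square_less_1[of x] by (simp add: min_def abs_mult)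
        finally show ?thesis
          using True by simp
      next
        case False
        have "norm (1 - iexp (\<theta> * x)) \<le> norm (1::complex) + norm (iexp (\<theta> * x))"
          by (rule norm_triangle_ineq4)
        also have "\<dots> \<le> 2 + \<theta>\<^sup>2"
          by simp
        also have "\<dots> = norm ((2 + \<theta>\<^sup>2) * min 1 (x\<^sup>2))"
          using False abs_square_less_1[of x] by (simp add: min_def abs_mult)
        finally show ?thesis
          using False by simp
      qed
    qed
  qed measurable
qed

text \<open>The real part is the sum of the Gaussian term and the integral of
  \<open>1 - cos (\<theta> * x)\<close>. Both are nonnegative, so both vanish.\<close>

lemma levy_exponent_imaginary:
  assumes \<nu>: "levy_measure \<nu>" and re: "\<And>\<theta>. Re (levy_exponent a \<sigma> \<nu> \<theta>) = 0"
  shows "\<sigma> = 0" "\<nu> = null_measure borel"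
proof -
  have sets [measurable_cong]: "sets \<nu> = sets borel"
    using \<nu> by (simp add: levy_measure_def)
  have Re_integrand: "Re (1 - iexp (\<theta> * x) + \<i> * of_real (\<theta> * x * indicator {x. \<bar>x\<bar> < 1} x)) = 1 - cos (\<theta> * x)"
    for \<theta> x :: real
    by (simp add: Re_exp)
  have int: "integrable \<nu> (\<lambda>x. 1 - cos (\<theta> * x))" for \<theta>
    using integrable_Re[OF integrable_levy_exponent[OF \<nu>, of \<theta>]] unfolding Re_integrand .
  have "Re (levy_exponent a \<sigma> \<nu> \<theta>) = \<sigma>\<^sup>2 * \<theta>\<^sup>2 / 2 + (\<integral>x. 1 - cos (\<theta> * x) \<partial>\<nu>)" for \<theta>
    using integral_Re[OF integrable_levy_exponent[OF \<nu>, of \<theta>]] unfolding Re_integrand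
    by (simp add: levy_exponent_def)
  then have sum: "\<sigma>\<^sup>2 * \<theta>\<^sup>2 / 2 + (\<integral>x. 1 - cos (\<theta> * x) \<partial>\<nu>) = 0" for \<theta>
    using re by metis
  have nonneg: "0 \<le> (\<integral>x. 1 - cos (\<theta> * x) \<partial>\<nu>)" for \<theta>
    by (intro integral_nonneg_AE AE_I2) simp
  have "\<sigma>\<^sup>2 = 0"
    using sum[of 1] nonneg[of 1] zero_le_power2[of \<sigma>] unfolding power_one mult_1_right by linarith
  then show "\<sigma> = 0" by simp
  then have "(\<integral>x. 1 - cos (\<theta> * x) \<partial>\<nu>) = 0" for \<theta>
    using sum[of \<theta>] by simp
  then have "AE x in \<nu>. 1 - cos (\<theta> * x) = 0" for \<theta>
    using int by (subst integral_nonneg_eq_0_iff_AE[symmetric]) auto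
  \<comment> \<open>Countably many frequencies share one null set, and they suffice: for
    \<open>n\<close> above \<open>\<bar>x\<bar>\<close> the argument has absolute value below 1,
    where the cosine is 1 only at 0.\<close>
  then have "AE x in \<nu>. \<forall>n. 1 - cos (1 / real (Suc n) * x) = 0"
    by (simp only: AE_all_countable) blast
  then have "AE x in \<nu>. x = 0"
  proof eventually_elim
    fix x :: real assume cos1: "\<forall>n. 1 - cos (1 / real (Suc n) * x) = 0"
    obtain n :: nat where n: "\<bar>x\<bar> < real n"
      using reals_Archimedean2 by blast
    define y where "y = \<bar>x\<bar> / real (Suc n)"
    have y: "0 \<le> y" "y < 1"
      using n by (auto simp: y_def divide_less_eq)
    have "cos y = 1"
    proof -
      have "cos y = cos (x / real (Suc n))"
        unfolding y_def by (cases "x \<ge> 0") auto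
      then show ?thesis
        using cos1[rule_format, of n] by simp
    qed
    have "y = 0"
    proof (rule ccontr)
      assume "y \<noteq> 0"
      then have "cos y < cos 0"
        using y pi_gt3 by (intro cos_monotone_0_pi) auto
      then show False
        using \<open>cos y = 1\<close> by simp
    qed
    then show "x = 0"
      by (simp add: y_def)
  qed
  moreover have "emeasure \<nu> {0} = 0"
    using \<nu> by (simp add: levy_measure_def)
  then have "AE x in \<nu>. x \<notin> {0}"
    by (intro AE_not_in) (simp add: null_sets_def sets)
  \<comment> \<open>Almost every point is 0, yet 0 carries no mass, so the total mass is 0.\<close>
  ultimately have "AE x in \<nu>. False"
    by eventually_elim simp
  then have "emeasure \<nu> (space \<nu>) = 0"
    by (subst (asm) AE_iff_measurable[OF sets.top]) auto
  then have "emeasure \<nu> A = 0" for A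
    using emeasure_space[of \<nu> A] by simp
  then show "\<nu> = null_measure borel"
    using sets by (intro measure_eqI) auto
qed

lemma levy_exponent_null: "levy_exponent a 0 (null_measure borel) \<theta> = - \<i> * of_real (a * \<theta>)"
  by (simp add: levy_exponent_def)

lemma iexp_eq_imp_eq:
  assumes "\<And>\<theta>. iexp (a * \<theta>) = iexp (c * \<theta>)"
  shows "a = c"
proof (rule ccontr)
  assume "a \<noteq> c"
  \<comment> \<open>At this frequency the two phases differ by \<open>pi\<close>, so the
    exponentials have opposite signs.\<close>
  define \<theta> where "\<theta> = pi / (a - c)"
  have "iexp (a * \<theta>) = iexp (c * \<theta> + pi)"
    using \<open>a \<noteq> c\<close> by (simp add: \<theta>_def field_simps)
  also have "\<dots> = - iexp (c * \<theta>)"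
    by (simp add: distrib_left exp_add)
  finally show False
    using assms[of \<theta>] by simp
qed

text \<open>Without jumps there is nothing to compensate; the frequency 1 identifies the
  coefficient.\<close>

lemma has_drift_coefficient_null: "has_drift_coefficient a 0 (null_measure borel) d \<longleftrightarrow> d = a"
proof
  assume "has_drift_coefficient a 0 (null_measure borel) d"
  then have "levy_exponent a 0 (null_measure borel) 1 = - \<i> * of_real d"
    by (simp add: has_drift_coefficient_def)
  then show "d = a"
    by (simp add: levy_exponent_null)
qed (simp add: has_drift_coefficient_def levy_exponent_null)

section \<open>Deterministic processes\<close>

context two_sided_levy_process
begin

text \<open>The characteristic function of a constant has modulus 1, so the exponent is purely
  imaginary; the remaining phase identifies \<open>a\<close>.\<close>

lemma levy_triplet_of_AE_const:
  assumes triplet: "levy_triplet M X a \<sigma> \<nu>" and X1: "AE \<omega> in M. X 1 \<omega> = c"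
  shows "\<sigma> = 0" "\<nu> = null_measure borel" "a = c"
proof -
  have char: "exp (- levy_exponent a \<sigma> \<nu> \<theta>) = iexp (c * \<theta>)" for \<theta>
  proof -
    have "exp (- levy_exponent a \<sigma> \<nu> \<theta>) = char (distr M borel (X 1)) \<theta>"
      using triplet by (simp add: levy_triplet_def)
    also have "\<dots> = (CLINT \<omega>|M. iexp (\<theta> * X 1 \<omega>))"
      by (simp add: char_def integral_distr)
    also have "\<dots> = (CLINT \<omega>|M. iexp (\<theta> * c))"
      using X1 by (intro integral_cong_AE) auto
    also have "\<dots> = iexp (c * \<theta>)"
      by (simp add: prob_space mult.commute)
    finally show ?thesis .
  qed
  have "exp (- Re (levy_exponent a \<sigma> \<nu> \<theta>)) = 1" for \<theta>
    using arg_cong[OF char[of \<theta>], of norm] by (simp add: norm_exp_eq_Re)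
  then have re: "Re (levy_exponent a \<sigma> \<nu> \<theta>) = 0" for \<theta>
    by simp
  have \<nu>: "levy_measure \<nu>"
    using triplet by (simp add: levy_triplet_def)
  note zero = levy_exponent_imaginary[OF \<nu> re]
  show "\<sigma> = 0" "\<nu> = null_measure borel"
    by (fact zero)+
  show "a = c"
    using char unfolding zero levy_exponent_null by (intro iexp_eq_imp_eq) simp
qed

text \<open>Uniqueness of characteristic functions makes each \<open>X t\<close> with
  \<open>t \<ge> 0\<close> a point mass, and stationarity of \<open>X 0 - X t\<close> covers
  negative times. The countably many dyadic times share a null set, and right-continuity gives the
  rest.\<close>

lemma AE_linear_of_null:
  assumes triplet: "levy_triplet M X a 0 (null_measure borel)"
  shows "AE \<omega> in M. \<forall>t. X t \<omega> = a * t"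
proof -
  have nonneg: "distr M borel (X t) = return borel (a * t)" if "t \<ge> 0" for t
  proof (rule Levy_uniqueness)
    show "real_distribution (distr M borel (X t))"
      by (rule real_distribution_distr) simp
    show "real_distribution (return borel (a * t))"
      by (simp add: real_distribution_def real_distribution_axioms_def prob_space_return)
    show "char (distr M borel (X t)) = char (return borel (a * t))"
    proof
      fix \<theta>
      have "char (distr M borel (X t)) \<theta> = exp (- of_real t * levy_exponent a 0 (null_measure borel) \<theta>)"
        using triplet that by (simp add: levy_triplet_def)
      also have "\<dots> = iexp (\<theta> * (a * t))"
        by (simp add: levy_exponent_null mult_ac)
      also have "\<dots> = char (return borel (a * t)) \<theta>"
        by (simp add: char_def integral_return)
      finally show "char (distr M borel (X t)) \<theta> = char (return borel (a * t)) \<theta>" .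
    qed
  qed
  have AE_const: "AE \<omega> in M. Y \<omega> = c"
    if "Y \<in> borel_measurable M" "distr M borel Y = return borel c" for Y :: "'w \<Rightarrow> real" and c
  proof -
    have "AE y in distr M borel Y. y = c"
      unfolding that(2) by (simp add: AE_return)
    then show ?thesis
      using that(1) by (simp add: AE_distr_iff)
  qed
  have "AE \<omega> in M. X t \<omega> = a * t" for t
  proof (cases "t \<ge> 0")
    case True
    then show ?thesis
      using nonneg by (intro AE_const) auto
  next
    case False
    then have "distr M borel (\<lambda>\<omega>. X 0 \<omega> - X t \<omega>) = return borel (a * (0 - t))"
      using nonneg[of "- t"] stationary_increment[of t 0] by simp
    then have "AE \<omega> in M. X 0 \<omega> - X t \<omega> = a * (0 - t)"
      by (rule AE_const[rotated]) simp
    with AE_space show ?thesis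
      by eventually_elim (simp add: X_zero)
  qed
  then have "AE \<omega> in M. \<forall>k z. X (of_int z / 2 ^ k) \<omega> = a * (of_int z / 2 ^ k)"
    unfolding AE_all_countable by blast
  with AE_space show ?thesis
    by eventually_elim (auto intro: cadlag_eq_of_dyadic cadlag_paths)
qed

section \<open>Mean of the process and existence of the minorant\<close>

lemma AE_minorant_of_mean_bound:
  assumes int: "integrable M (X 1)" and mean: "\<bar>expectation (X 1)\<bar> < \<alpha>"
  shows "AE \<omega> in M. \<exists>m. is_lipschitz_minorant \<alpha> (\<lambda>t. X t \<omega>) m"
proof -
  have \<alpha>: "\<alpha> \<ge> 0"
    using mean by linarith
  \<comment> \<open>The mean bound makes the drifted walk have positive mean for both signs.\<close>
  have "AE \<omega> in M. \<exists>C::nat. \<forall>k j :: nat. - real C \<le> drifted 1 \<alpha> (real j / 2 ^ k) \<omega>"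
    using mean \<alpha> int by (intro AE_drifted_bdd_below_dyadic) auto
  moreover have "AE \<omega> in M. \<exists>C::nat. \<forall>k j :: nat. - real C \<le> drifted (-1) \<alpha> (real j / 2 ^ k) \<omega>"
    using mean \<alpha> int by (intro AE_drifted_bdd_below_dyadic) auto
  ultimately show ?thesis
    using AE_space
  proof eventually_elim
    case (elim \<omega>)
    then obtain C1 C2 :: nat
      where C1: "\<And>k j :: nat. - real C1 \<le> drifted 1 \<alpha> (real j / 2 ^ k) \<omega>"
        and C2: "\<And>k j :: nat. - real C2 \<le> drifted (-1) \<alpha> (real j / 2 ^ k) \<omega>"
      by blast
    have "- real (C1 + C2) - \<alpha> * \<bar>t\<bar> \<le> X t \<omega>" for t
    proof (rule cadlag_ge_of_dyadic[OF cadlag_paths])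
      fix k j :: nat
      show "- real (C1 + C2) - \<alpha> * (real j / 2 ^ k) \<le> X (real j / 2 ^ k) \<omega>"
        using C1[of j k] by (simp add: drifted_def)
      show "- real (C1 + C2) - \<alpha> * (real j / 2 ^ k) \<le> X (- (real j / 2 ^ k)) \<omega>"
        using C2[of j k] by (simp add: drifted_def)
    qed (use elim in simp)
    then show ?case
      by (rule lipschitz_minorant_exists[OF \<alpha>])
  qed
qed

text \<open>The boundary means are expressed through the constancy of \<open>X 1\<close>, the form
  from which the triplet can be read off.\<close>

lemma mean_bound_of_AE_minorant:
  assumes \<alpha>: "\<alpha> > 0" and minorant: "AE \<omega> in M. \<exists>m. is_lipschitz_minorant \<alpha> (\<lambda>t. X t \<omega>) m"
  shows "integrable M (X 1) \<and> \<bar>expectation (X 1)\<bar> < \<alpha>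
    \<or> (AE \<omega> in M. X 1 \<omega> = \<alpha>) \<or> (AE \<omega> in M. X 1 \<omega> = - \<alpha>)"
proof -
  have bdd: "AE \<omega> in M. sums_bdd_below (\<lambda>n. walk \<epsilon> \<alpha> 1 n \<omega>)" if "\<epsilon> = 1 \<or> \<epsilon> = -1" for \<epsilon>
    using minorant AE_space
  proof eventually_elim
    case (elim \<omega>)
    then obtain m where m: "is_lipschitz_minorant \<alpha> (\<lambda>t. X t \<omega>) m"
      by blast
    show ?case
    proof (rule sums_bdd_belowI)
      fix n
      show "m 0 \<le> (\<Sum>i<n. walk \<epsilon> \<alpha> 1 i \<omega>)"
        using is_lipschitz_minorant_bound[OF m, of "\<epsilon> * real n"] that elim(2)
        by (auto simp: sum_walk drifted_def)
    qed
  qed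
  interpret fwd: iid_walk M "walk 1 \<alpha> 1"
    by (rule iid_walk_walk) auto
  interpret bwd: iid_walk M "walk (-1) \<alpha> 1"
    by (rule iid_walk_walk) auto
  \<comment> \<open>A forward step is an increment of \<open>X\<close> plus \<open>\<alpha>\<close>;
    subtracted from \<open>2 * \<alpha>\<close> it has the law of a backward step. The lower bound
    on the negative half-line thus becomes an upper bound for the forward walk.\<close>
  interpret mir: iid_walk M "\<lambda>n \<omega>. 2 * \<alpha> - walk 1 \<alpha> 1 n \<omega>"
    by (rule fwd.iid_walk_compose) simp
  have "distr M borel (\<lambda>\<omega>. 2 * \<alpha> - walk 1 \<alpha> 1 0 \<omega>) = distr (distr M borel (walk 1 \<alpha> 1 0)) borel (\<lambda>x. 2 * \<alpha> - x)"
    by (subst distr_distr) (auto simp: comp_def)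
  also have "\<dots> = distr M borel (walk (-1) \<alpha> 1 0)"
    by (simp add: distr_walk distr_distr comp_def)
  finally have mir_bwd: "distr M borel (\<lambda>\<omega>. 2 * \<alpha> - walk 1 \<alpha> 1 0 \<omega>) = distr M borel (walk (-1) \<alpha> 1 0)" .
  have "AE \<omega> in M. sums_bdd_below (\<lambda>n. 2 * \<alpha> - walk 1 \<alpha> 1 n \<omega>)"
    using bdd[of "-1"] mir.AE_steps_iff[OF bwd.iid_walk_axioms mir_bwd pred_sums_bdd_below] by simp
  moreover have "AE \<omega> in M. sums_bdd_below (\<lambda>n. walk 1 \<alpha> 1 n \<omega>)"
    by (rule bdd) simp
  ultimately have "AE \<omega> in M. \<exists>K::nat. \<forall>n. \<bar>walk 1 \<alpha> 1 n \<omega>\<bar> \<le> 2 * \<alpha> * real n + real K"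
  proof eventually_elim
    case (elim \<omega>)
    define V where "V n = walk 1 \<alpha> 1 n \<omega>" for n
    obtain C1 C2 :: nat where C1: "\<And>n. - real C1 \<le> (\<Sum>i<n. V i)" and C2: "\<And>n. - real C2 \<le> (\<Sum>i<n. 2 * \<alpha> - V i)"
      using elim by (auto simp: sums_bdd_below_def V_def)
    \<comment> \<open>\<open>V n\<close> is the difference of two consecutive sums, which lie
      between \<open>- C1\<close> and a bound growing by \<open>2 * \<alpha>\<close> per step; the
      constant \<open>2 * \<alpha>\<close> comes from the upper bound at
      \<open>Suc n\<close>.\<close>
    obtain K :: nat where K: "2 * \<alpha> + real C1 + real C2 \<le> real K"
      using real_arch_simple by blast
    have "\<bar>V n\<bar> \<le> 2 * \<alpha> * real n + real K" for n
    proof -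
      have mir: "- real C2 \<le> 2 * \<alpha> * real n - (\<Sum>i<n. V i)" for n
        using C2[of n] by (simp add: sum_subtractf mult.commute)
      have "2 * \<alpha> * real (Suc n) = 2 * \<alpha> * real n + 2 * \<alpha>"
        by (simp add: distrib_left)
      then show ?thesis
        using C1[of n] C1[of "Suc n"] mir[of n] mir[of "Suc n"] K \<alpha> unfolding sum.lessThan_Suc by linarith
    qed
    then show ?case
      unfolding V_def by blast
  qed
  then have "integrable M (walk 1 \<alpha> 1 0)"
    using \<alpha> by (intro fwd.integrable_of_linear_growth) auto
  then have int: "integrable M (X 1)"
    using integrable_walk by blast
  have nonneg: "0 \<le> expectation (X 1) + \<alpha>" "0 \<le> - expectation (X 1) + \<alpha>"
    using fwd.expectation_nonneg_of_bdd_below bwd.expectation_nonneg_of_bdd_below bdd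
      integrable_walk[of 1 \<alpha>] integrable_walk[of "-1" \<alpha>]
      expectation_walk[of 1 \<alpha>] expectation_walk[of "-1" \<alpha>] int by auto
  \<comment> \<open>A mean on the boundary gives one of the two walks mean 0. Being bounded below,
    it has vanishing steps.\<close>
  have "AE \<omega> in M. X 1 \<omega> = - \<epsilon> * \<alpha>"
    if \<epsilon>: "\<epsilon> = 1 \<or> \<epsilon> = -1" and mean: "\<epsilon> * expectation (X 1) + \<alpha> = 0" for \<epsilon>
  proof -
    interpret iid_walk M "walk \<epsilon> \<alpha> 1"
      using \<epsilon> by (rule iid_walk_walk) simp
    have "AE \<omega> in M. walk \<epsilon> \<alpha> 1 0 \<omega> = 0"
      using \<epsilon> mean int bdd[OF \<epsilon>] by (intro AE_eq_0_of_bdd_below) (auto simp: integrable_walk expectation_walk)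
    then have "AE x in distr M borel (walk \<epsilon> \<alpha> 1 0). x = 0"
      by (simp add: AE_distr_iff)
    then have "AE \<omega> in M. \<epsilon> * X 1 \<omega> + \<alpha> = 0"
      unfolding distr_walk[OF \<epsilon> zero_less_one] by (simp add: AE_distr_iff)
    then show ?thesis
      by eventually_elim (use \<epsilon> in auto)
  qed
  from this[of 1] this[of "-1"] show ?thesis
    using nonneg int by (cases "expectation (X 1) = \<alpha>"; cases "expectation (X 1) = - \<alpha>") auto
qed

end

theorem proposition2p1:
  fixes M :: "'w measure" and X :: "real \<Rightarrow> 'w \<Rightarrow> real"
    and a \<sigma> \<alpha> :: real and \<nu> :: "real measure"
  assumes "two_sided_levy_process M X"
    and "levy_triplet M X a \<sigma> \<nu>"
    and "\<alpha> > 0"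
  shows "((AE \<omega> in M. \<exists>m. is_lipschitz_minorant \<alpha> (\<lambda>t. X t \<omega>) m) \<longleftrightarrow>
            (\<sigma> = 0 \<and> \<nu> = null_measure borel \<and>
               (\<exists>d. has_drift_coefficient a \<sigma> \<nu> d \<and> \<bar>d\<bar> = \<alpha>)) \<or>
            (integrable M (X 1) \<and> \<bar>\<integral>\<omega>. X 1 \<omega> \<partial>M\<bar> < \<alpha>))
       \<and> ((\<sigma> = 0 \<and> \<nu> = null_measure borel \<and>
               (\<exists>d. has_drift_coefficient a \<sigma> \<nu> d \<and> \<bar>d\<bar> = \<alpha>)) \<longleftrightarrow>
            (AE \<omega> in M. \<forall>t. X t \<omega> = \<alpha> * t) \<or> (AE \<omega> in M. \<forall>t. X t \<omega> = - \<alpha> * t))"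
proof -
  interpret two_sided_levy_process M X
    by fact
  let ?det = "\<sigma> = 0 \<and> \<nu> = null_measure borel \<and> (\<exists>d. has_drift_coefficient a \<sigma> \<nu> d \<and> \<bar>d\<bar> = \<alpha>)"
  have det_iff: "?det \<longleftrightarrow> \<sigma> = 0 \<and> \<nu> = null_measure borel \<and> \<bar>a\<bar> = \<alpha>"
    using has_drift_coefficient_null by auto
  have det_of_const: "?det" if "AE \<omega> in M. X 1 \<omega> = c" "\<bar>c\<bar> = \<alpha>" for c
    unfolding det_iff using levy_triplet_of_AE_const[OF assms(2) that(1)] that(2) by simp
  have linear: "AE \<omega> in M. \<forall>t. X t \<omega> = a * t" if ?det
    using assms(2) that by (intro AE_linear_of_null) auto
  have det_minorant: "AE \<omega> in M. \<exists>m. is_lipschitz_minorant \<alpha> (\<lambda>t. X t \<omega>) m" if det: ?det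
    using linear[OF det]
  proof eventually_elim
    case (elim \<omega>)
    \<comment> \<open>The constant 0 works because the path is a line of slope
      \<open>\<alpha>\<close> or \<open>- \<alpha>\<close> through the origin.\<close>
    have "0 - \<alpha> * \<bar>t\<bar> \<le> X t \<omega>" for t
    proof -
      have "\<bar>a * t\<bar> = \<alpha> * \<bar>t\<bar>"
        using det unfolding det_iff by (simp add: abs_mult)
      then show ?thesis
        using elim[rule_format, of t] by linarith
    qed
    then show ?case
      by (rule lipschitz_minorant_exists[OF less_imp_le[OF assms(3)]])
  qed
  have "(AE \<omega> in M. \<exists>m. is_lipschitz_minorant \<alpha> (\<lambda>t. X t \<omega>) m) \<longleftrightarrow>
      ?det \<or> integrable M (X 1) \<and> \<bar>\<integral>\<omega>. X 1 \<omega> \<partial>M\<bar> < \<alpha>"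
    using mean_bound_of_AE_minorant[OF assms(3)] AE_minorant_of_mean_bound det_minorant
      det_of_const[of \<alpha>] det_of_const[of "- \<alpha>"] assms(3) by auto
  moreover have "?det \<longleftrightarrow> (AE \<omega> in M. \<forall>t. X t \<omega> = \<alpha> * t) \<or> (AE \<omega> in M. \<forall>t. X t \<omega> = - \<alpha> * t)"
  proof
    assume det: ?det
    then have "a = \<alpha> \<or> a = - \<alpha>"
      unfolding det_iff by auto
    then show "(AE \<omega> in M. \<forall>t. X t \<omega> = \<alpha> * t) \<or> (AE \<omega> in M. \<forall>t. X t \<omega> = - \<alpha> * t)"
      using linear[OF det] by metis
  next
    assume "(AE \<omega> in M. \<forall>t. X t \<omega> = \<alpha> * t) \<or> (AE \<omega> in M. \<forall>t. X t \<omega> = - \<alpha> * t)"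
    then show ?det
    proof
      assume "AE \<omega> in M. \<forall>t. X t \<omega> = \<alpha> * t"
      \<comment> \<open>The value at time 1 alone already determines the triplet.\<close>
      then have "AE \<omega> in M. X 1 \<omega> = \<alpha>"
        by eventually_elim simp
      then show ?det
        by (rule det_of_const) (use assms(3) in simp)
    next
      assume "AE \<omega> in M. \<forall>t. X t \<omega> = - \<alpha> * t"
      then have "AE \<omega> in M. X 1 \<omega> = - \<alpha>"
        by eventually_elim simp
      then show ?det
        by (rule det_of_const) (use assms(3) in simp)
    qed
  qed
  ultimately show ?thesis
    by blast
qed

end
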